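(* Let $\Gamma$ be a connected strongly regular graph with parameters $(v,k,\lambda,\mu)$, with Laplacian $L$ whose two distinct nonzero eigenvalues $r$ and $s$ (with multiplicities $f$ and $g$) are integers. Let $p$ be a prime dividing $|K(\Gamma)|$, let $K_p(\Gamma)$ be the Sylow $p$-subgroup of the critical group $K(\Gamma)$, and let $e_0$ be the $p$-rank of $L$. Suppose $p \parallel r$ and $p^2 \parallel s$, and let $\gamma$ be the nonnegative integer with $p^\gamma \parallel v$. Then either \[ K_p(\Gamma) \cong (\mathbb{Z}/p\mathbb{Z})^{f-e_0} \oplus (\mathbb{Z}/p^2\mathbb{Z})^{g+\gamma-e_0} \oplus (\mathbb{Z}/p^3\mathbb{Z})^{e_0-\gamma} \] or \[ K_p(\Gamma) \cong (\mathbb{Z}/p\mathbb{Z})^{f+1-e_0} \oplus (\mathbb{Z}/p^2\mathbb{Z})^{g+\gamma-2-e_0} \oplus (\mathbb{Z}/p^3\mathbb{Z})^{e_0-\gamma+1}. \] Furthermore, if $\gamma = 0$ then \[ K_p(\Gamma) \cong (\mathbb{Z}/p\mathbb{Z})^{f-e_0} \oplus (\mathbb{Z}/p^2\mathbb{Z})^{g-e_0} \oplus (\mathbb{Z}/p^3\mathbb{Z})^{e_0}. \] The same statement holds with the roles of $r$ and $s$ interchanged and the roles of $f$ and $g$ interchanged.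
   Context: A graph is strongly regular with parameters $(v,k,\lambda,\mu)$ if it has $v$ vertices, is $k$-regular, any two adjacent vertices have exactly $\lambda$ common neighbours, and any two non-adjacent vertices have exactly $\mu$ common neighbours. The Laplacian is $L = kI - A$, where $A$ is the adjacency matrix; $0$ is an eigenvalue of $L$ of multiplicity one and $L$ has exactly two other distinct eigenvalues $r,s$, with multiplicities $f,g$. Viewing $L$ as a map $\mathbb{Z}^{\mathcal{V}} \to \mathbb{Z}^{\mathcal{V}}$, its cokernel decomposes as $K(\Gamma) \oplus \mathbb{Z}$ with $K(\Gamma)$ finite abelian; $K(\Gamma)$ is the critical group. The $p$-rank of $L$ is its rank over the field with $p$ elements. $p^a \parallel n$ means $p^a \mid n$ and $p^{a+1} \nmid n$. *)

theory Defs
  imports "HOL-Analysis.Analysis" "HOL-Algebra.Algebra"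
begin

definition srg :: "('n::finite \<Rightarrow> 'n \<Rightarrow> bool) \<Rightarrow> nat \<Rightarrow> nat \<Rightarrow> nat \<Rightarrow> nat \<Rightarrow> bool" where
  "srg E v k lam mu \<longleftrightarrow>
     (\<forall>x. \<not> E x x) \<and> (\<forall>x y. E x y \<longrightarrow> E y x) \<and>
     CARD('n) = v \<and>
     (\<forall>x. card {y. E x y} = k) \<and>
     (\<forall>x y. E x y \<longrightarrow> card {z. E x z \<and> E y z} = lam) \<and>
     (\<forall>x y. x \<noteq> y \<and> \<not> E x y \<longrightarrow> card {z. E x z \<and> E y z} = mu)"

definition graph_connected :: "('n \<Rightarrow> 'n \<Rightarrow> bool) \<Rightarrow> bool" where
  "graph_connected E \<longleftrightarrow> (\<forall>x y. E\<^sup>*\<^sup>* x y)"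

definition adj_matrix :: "('n::finite \<Rightarrow> 'n \<Rightarrow> bool) \<Rightarrow> int^'n^'n" where
  "adj_matrix E = (\<chi> i j. if E i j then 1 else 0)"

definition laplacian :: "('n::finite \<Rightarrow> 'n \<Rightarrow> bool) \<Rightarrow> nat \<Rightarrow> int^'n^'n" where
  "laplacian E k = mat (int k) - adj_matrix E"

definition real_mat :: "int^'n^'m \<Rightarrow> real^'n^'m" where
  "real_mat A = (\<chi> i j. real_of_int (A $ i $ j))"

definition is_eigenvalue :: "real^'n^'n \<Rightarrow> real \<Rightarrow> bool" where
  "is_eigenvalue A c \<longleftrightarrow> (\<exists>x. x \<noteq> 0 \<and> A *v x = c *\<^sub>R x)"

text \<open>Multiplicity of an eigenvalue of a (real symmetric) matrix: dimension of its eigenspace.\<close>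
definition eig_mult :: "real^'n^'n \<Rightarrow> real \<Rightarrow> nat" where
  "eig_mult A c = dim {x. A *v x = c *\<^sub>R x}"

text \<open>The p-rank: rank over GF(p), i.e. maximal number of rows that are linearly
  independent modulo p.\<close>
definition p_rank :: "nat \<Rightarrow> int^'n::finite^'n \<Rightarrow> nat" where
  "p_rank p A = Max {card S | S. \<forall>c :: 'n \<Rightarrow> int.
       (\<forall>j. int p dvd (\<Sum>i\<in>S. c i * A $ i $ j)) \<longrightarrow> (\<forall>i\<in>S. int p dvd c i)}"

definition lattice_group :: "(int^'n) monoid" where
  "lattice_group = \<lparr>carrier = UNIV, monoid.mult = (+), one = 0\<rparr>"

definition cokernel :: "int^'n::finite^'n \<Rightarrow> (int^'n) set monoid" where
  "cokernel A = lattice_group Mod range (\<lambda>x. A *v x)"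

definition critical_group :: "('n::finite \<Rightarrow> 'n \<Rightarrow> bool) \<Rightarrow> nat \<Rightarrow> (int^'n) set monoid" where
  "critical_group E k =
     (let C = cokernel (laplacian E k) in
      C\<lparr>carrier := {a \<in> carrier C. \<exists>n::nat. n > 0 \<and> a [^]\<^bsub>C\<^esub> n = \<one>\<^bsub>C\<^esub>}\<rparr>)"

text \<open>Sylow p-subgroup of a finite abelian group: the elements of p-power order.\<close>
definition sylow_part :: "nat \<Rightarrow> ('a, 'b) monoid_scheme \<Rightarrow> ('a, 'b) monoid_scheme" where
  "sylow_part p G = G\<lparr>carrier := {a \<in> carrier G. \<exists>e::nat. a [^]\<^bsub>G\<^esub> (p ^ e) = \<one>\<^bsub>G\<^esub>}\<rparr>"

definition abelian_type3 :: "nat \<Rightarrow> nat \<Rightarrow> nat \<Rightarrow> nat \<Rightarrow> ((nat \<Rightarrow> int) \<times> (nat \<Rightarrow> int) \<times> (nat \<Rightarrow> int)) monoid" where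
  "abelian_type3 p a b c =
     sum_group {..<a} (\<lambda>_. integer_mod_group p) \<times>\<times>
     sum_group {..<b} (\<lambda>_. integer_mod_group (p^2)) \<times>\<times>
     sum_group {..<c} (\<lambda>_. integer_mod_group (p^3))"

definition has_type3 :: "('x, 'y) monoid_scheme \<Rightarrow> nat \<Rightarrow> int \<Rightarrow> int \<Rightarrow> int \<Rightarrow> bool" where
  "has_type3 G p a b c \<longleftrightarrow> a \<ge> 0 \<and> b \<ge> 0 \<and> c \<ge> 0 \<and> G \<cong> abelian_type3 p (nat a) (nat b) (nat c)"

definition exactly_divides :: "nat \<Rightarrow> nat \<Rightarrow> int \<Rightarrow> bool" where
  "exactly_divides p a n \<longleftrightarrow> int p ^ a dvd n \<and> \<not> int p ^ (a + 1) dvd n"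

end

theory Submission
  imports Defs
begin

text \<open>
  The Laplacian \<open>L\<close> satisfies \<open>(L - r)(L - s) = \<mu> J\<close>. Diagonalise it over the integers,
  \<open>P L Q = diag d\<close> with \<open>P\<close>, \<open>Q\<close> unimodular: exactly one entry \<open>d z\<close> vanishes, and row \<open>z\<close> of \<open>P\<close>
  and column \<open>z\<close> of \<open>Q\<close> are \<open>\<plusminus>1\<close>. Let \<open>e\<^sub>m\<close> be the number of nonzero \<open>d i\<close> of \<open>p\<close>-adic valuation \<open>m\<close>;
  then \<open>e\<^sub>0\<close> is the \<open>p\<close>-rank and \<open>e\<^sub>1\<close>, \<open>e\<^sub>2\<close>, \<dots> give the type of the Sylow subgroup.

  Since \<open>d i\<close> divides \<open>r s\<close> for \<open>i \<noteq> z\<close>, only \<open>m \<le> 3\<close> occurs, so \<open>e\<^sub>0 + e\<^sub>1 + e\<^sub>2 + e\<^sub>3 = f + g\<close>.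
  Evaluating \<open>det (L + J)\<close> in an eigenbasis and through \<open>P\<close>, \<open>Q\<close> gives
  \<open>e\<^sub>1 + 2 e\<^sub>2 + 3 e\<^sub>3 = f + 2 g - \<gamma>\<close>. An integral eigenvector \<open>x\<close> for \<open>c\<close> satisfies
  \<open>d i (Q\<^sup>-\<^sup>1 x) i = c (P x) i\<close>; choosing it primitive and orthogonal to suitable rows of \<open>P\<close> or of
  \<open>Q\<^sup>-\<^sup>1\<close> yields \<open>e\<^sub>0 + e\<^sub>1 \<ge> f\<close> for \<open>c = r\<close>, and \<open>e\<^sub>2 + e\<^sub>3 + 1 \<ge> g\<close> for \<open>c = s\<close>, where the summand \<open>1\<close>
  (the index \<open>z\<close>) can be dropped if \<open>p\<close> does not divide \<open>v\<close>. Hence \<open>g - (e\<^sub>2 + e\<^sub>3)\<close> is \<open>0\<close> or \<open>1\<close>,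
  which is the dichotomy of the theorem.
\<close>

section \<open>Diagonalisation of integer matrices\<close>

definition unimod_equiv :: "int^'n::finite^'n \<Rightarrow> int^'n^'n \<Rightarrow> bool" where
  "unimod_equiv A B \<longleftrightarrow> (\<exists>P Q. invertible P \<and> invertible Q \<and> B = P ** A ** Q)"

lemma invertible_mat_1: "invertible (mat 1 :: int^'n::finite^'n)"
  unfolding invertible_def by (rule exI[of _ "mat 1"]) simp


lemma unimod_equiv_refl: "unimod_equiv A A"
proof -
  have "A = mat 1 ** A ** mat 1" by simp
  then show ?thesis unfolding unimod_equiv_def using invertible_mat_1 by blast
qed

lemma unimod_equiv_trans:
  assumes "unimod_equiv A B" "unimod_equiv B C"
  shows "unimod_equiv A C"
proof -
  obtain P Q P' Q' where *: "invertible P" "invertible Q" "B = P ** A ** Q"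
    "invertible P'" "invertible Q'" "C = P' ** B ** Q'"
    using assms unfolding unimod_equiv_def by blast
  have "C = (P' ** P) ** A ** (Q ** Q')"
    using * by (simp add: matrix_mul_assoc)
  moreover have "invertible (P' ** P)" "invertible (Q ** Q')"
    using * by (simp_all add: invertible_mult)
  ultimately show ?thesis
    unfolding unimod_equiv_def by blast
qed

lemma invertible_transpose_int:
  fixes A :: "int^'n::finite^'n"
  assumes "invertible A"
  shows "invertible (transpose A)"
proof -
  obtain B where "A ** B = mat 1" "B ** A = mat 1"
    using assms unfolding invertible_def by blast
  then have "transpose B ** transpose A = mat 1" "transpose A ** transpose B = mat 1"
    by (simp_all flip: matrix_transpose_mul)
  then show ?thesis unfolding invertible_def by blast
qed

lemma unimod_equiv_transpose:
  assumes "unimod_equiv A B"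
  shows "unimod_equiv (transpose A) (transpose B)"
proof -
  obtain P Q where *: "invertible P" "invertible Q" "B = P ** A ** Q"
    using assms unfolding unimod_equiv_def by blast
  then have "transpose B = transpose Q ** transpose A ** transpose P"
    by (simp add: matrix_transpose_mul matrix_mul_assoc)
  moreover have "invertible (transpose P)" "invertible (transpose Q)"
    using * by (simp_all add: invertible_transpose_int)
  ultimately show ?thesis
    unfolding unimod_equiv_def by blast
qed

section \<open>Elementary operations and the reduction to diagonal form\<close>

definition row_op :: "'n \<Rightarrow> ('n \<Rightarrow> int) \<Rightarrow> int^'n::finite^'n \<Rightarrow> int^'n^'n" where
  "row_op a q A = (\<chi> i j. A $ i $ j + (if i = a then 0 else q i * A $ a $ j))"

lemma row_op_as_mult:
  "row_op a q A = (\<chi> i j. if i = j then 1 else if j = a then q i else 0) ** A"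
proof -
  have "(\<Sum>k\<in>UNIV. (if i = k then 1 else if k = a then q i else 0) * A $ k $ j)
      = A $ i $ j + (if i = a then 0 else q i * A $ a $ j)" for i j
  proof -
    have "(\<Sum>k\<in>UNIV. (if i = k then 1 else if k = a then q i else 0) * A $ k $ j)
      = (\<Sum>k\<in>UNIV. (if k = i then A $ i $ j else 0) + (if k = a then (if i = a then 0 else q i * A $ a $ j) else 0))"
      by (rule sum.cong) auto
    then show ?thesis by (simp add: sum.distrib)
  qed
  then show ?thesis
    by (simp add: row_op_def matrix_matrix_mult_def vec_eq_iff)
qed

lemma row_op_inverse: "row_op a (\<lambda>i. - q i) (row_op a q A) = A"
  by (simp add: row_op_def vec_eq_iff)

text \<open>The elementary matrix is \<open>row_op a q\<close> applied to the identity. Row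
  \<open>a\<close> itself stays fixed, so negating \<open>q\<close> undoes the operation and gives
  the inverse matrix. Treating all rows at once allows a whole column to be cleared in one
  step.\<close>

lemma unimod_equiv_row_op:
  fixes A :: "int^'n::finite^'n"
  shows "unimod_equiv A (row_op a q A)"
proof -
  let ?R = "\<lambda>q. (\<chi> i j. if i = j then 1 else if j = a then q i else 0) :: int^'n^'n"
  have "?R (\<lambda>i. - q i) ** ?R q = mat 1" for q
    using row_op_inverse[of a q "mat 1"] by (simp add: row_op_as_mult)
  from this[of q] this[of "\<lambda>i. - q i"] have "invertible (?R q)"
    unfolding invertible_def minus_minus by blast
  moreover have "row_op a q A = ?R q ** A ** mat 1"
    by (simp add: row_op_as_mult)
  ultimately show ?thesis
    unfolding unimod_equiv_def using invertible_mat_1 by blast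
qed

definition col_op :: "'n \<Rightarrow> ('n \<Rightarrow> int) \<Rightarrow> int^'n::finite^'n \<Rightarrow> int^'n^'n" where
  "col_op a q A = (\<chi> i j. A $ i $ j + (if j = a then 0 else q j * A $ i $ a))"

lemma unimod_equiv_col_op: "unimod_equiv A (col_op a q A)"
proof -
  have "col_op a q A = transpose (row_op a q (transpose A))"
    by (simp add: col_op_def row_op_def transpose_def vec_eq_iff)
  then show ?thesis
    using unimod_equiv_transpose[OF unimod_equiv_row_op[of "transpose A" a q]] by simp
qed

text \<open>\<open>S\<close> records the pivots already processed; the induction below enlarges it
  by one index at a time.\<close>

definition split_off :: "'n set \<Rightarrow> int^'n::finite^'n \<Rightarrow> bool" where
  "split_off S A \<longleftrightarrow> (\<forall>i\<in>S. \<forall>j. i \<noteq> j \<longrightarrow> A $ i $ j = 0 \<and> A $ j $ i = 0)"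

lemma split_off_row_op:
  assumes "split_off S A" "a \<notin> S" "\<And>i. i \<in> S \<Longrightarrow> q i = 0"
  shows "split_off S (row_op a q A)"
  using assms by (auto simp: split_off_def row_op_def)

lemma split_off_col_op:
  assumes "split_off S A" "a \<notin> S" "\<And>i. i \<in> S \<Longrightarrow> q i = 0"
  shows "split_off S (col_op a q A)"
  using assms by (auto simp: split_off_def col_op_def)

text \<open>Among all equivalent matrices that split off \<open>S\<close>, a nonzero entry of least absolute value
  outside \<open>S\<close> divides its row and its column, since a remainder would be a smaller entry.\<close>
lemma unimod_equiv_diagonal_aux:
  fixes A :: "int^'n::finite^'n"
  assumes "split_off S A"
  shows "\<exists>B. unimod_equiv A B \<and> (\<forall>i j. i \<noteq> j \<longrightarrow> B $ i $ j = 0)"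
  using assms
proof (induction "card (UNIV - S)" arbitrary: S A rule: less_induct)
  case less
  define EQ where "EQ = {B. unimod_equiv A B \<and> split_off S B}"
  have EQ_row: "row_op a q B \<in> EQ" if "B \<in> EQ" "a \<notin> S" "\<And>i. i \<in> S \<Longrightarrow> q i = 0" for B a q
    using that by (auto simp: EQ_def intro: split_off_row_op unimod_equiv_trans[OF _ unimod_equiv_row_op])
  have EQ_col: "col_op a q B \<in> EQ" if "B \<in> EQ" "a \<notin> S" "\<And>i. i \<in> S \<Longrightarrow> q i = 0" for B a q
    using that by (auto simp: EQ_def intro: split_off_col_op unimod_equiv_trans[OF _ unimod_equiv_col_op])
  have AEQ: "A \<in> EQ" using less.prems unimod_equiv_refl by (auto simp: EQ_def)
  define N where "N = (\<lambda>m. \<exists>B a b. B \<in> EQ \<and> a \<notin> S \<and> b \<notin> S \<and> B $ a $ b \<noteq> 0 \<and> m = nat \<bar>B $ a $ b\<bar>)"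
  show ?case
  proof (cases "\<exists>m. N m")
    case False
    then have "A $ a $ b = 0" if "a \<notin> S" "b \<notin> S" for a b
      using that AEQ unfolding N_def by blast
    then have "A $ i $ j = 0" if "i \<noteq> j" for i j
      using less.prems that by (cases "i \<in> S"; cases "j \<in> S") (auto simp: split_off_def)
    then show ?thesis using unimod_equiv_refl by blast
  next
    case True
    define m where "m = (LEAST m. N m)"
    have Nm: "N m" using True unfolding m_def by (auto intro: LeastI)
    have min: "B $ a $ b = 0" if "B \<in> EQ" "a \<notin> S" "b \<notin> S" "\<bar>B $ a $ b\<bar> < int m" for B a b
    proof (rule ccontr)
      assume "B $ a $ b \<noteq> 0"
      then have "N (nat \<bar>B $ a $ b\<bar>)" using that unfolding N_def by blast
      then have "m \<le> nat \<bar>B $ a $ b\<bar>" unfolding m_def by (rule Least_le)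
      then show False using that by linarith
    qed
    obtain B0 a0 b where B0: "B0 \<in> EQ" "a0 \<notin> S" "b \<notin> S" "B0 $ a0 $ b \<noteq> 0" "m = nat \<bar>B0 $ a0 $ b\<bar>"
      using Nm unfolding N_def by blast
    have dvd_col: "B $ a $ b dvd B $ i $ b"
      if B: "B \<in> EQ" "a \<notin> S" "b \<notin> S" "i \<notin> S" "B $ a $ b \<noteq> 0" "int m = \<bar>B $ a $ b\<bar>" for B a b i
    proof (cases "i = a")
      case False
      let ?q = "\<lambda>k. if k = i then - (B $ i $ b div B $ a $ b) else 0"
      have e: "row_op a ?q B $ i $ b = B $ i $ b mod B $ a $ b"
        using False by (simp add: row_op_def minus_div_mult_eq_mod)
      have "row_op a ?q B $ i $ b = 0"
        using B e by (intro min EQ_row) (auto simp: abs_mod_less)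
      then show ?thesis using e by (simp add: mod_eq_0_iff_dvd)
    qed auto
    have dvd_row: "B $ a $ b dvd B $ a $ i"
      if B: "B \<in> EQ" "a \<notin> S" "b \<notin> S" "i \<notin> S" "B $ a $ b \<noteq> 0" "int m = \<bar>B $ a $ b\<bar>" for B a b i
    proof (cases "i = b")
      case False
      let ?q = "\<lambda>k. if k = i then - (B $ a $ i div B $ a $ b) else 0"
      have e: "col_op b ?q B $ a $ i = B $ a $ i mod B $ a $ b"
        using False by (simp add: col_op_def minus_div_mult_eq_mod)
      have "col_op b ?q B $ a $ i = 0"
        using B e by (intro min EQ_col) (auto simp: abs_mod_less)
      then show ?thesis using e by (simp add: mod_eq_0_iff_dvd)
    qed auto
    obtain B where B: "B \<in> EQ" "B $ b $ b \<noteq> 0" "int m = \<bar>B $ b $ b\<bar>"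
    proof (cases "a0 = b")
      case True
      then show ?thesis using that[of B0] B0 by auto
    next
      case False
      \<comment> \<open>A minimal entry may lie off the diagonal. The coefficient
        \<open>1 - quotient\<close> turns the entry at \<open>(b, b)\<close> into exactly that
        minimal entry.\<close>
      let ?q = "\<lambda>k. if k = b then 1 - (B0 $ b $ b div B0 $ a0 $ b) else 0"
      have "B0 $ a0 $ b dvd B0 $ b $ b" using dvd_col[of B0 a0 b b] B0 by auto
      then have e: "row_op a0 ?q B0 $ b $ b = B0 $ a0 $ b"
        using False by (simp add: row_op_def algebra_simps)
      show ?thesis
        by (rule that[of "row_op a0 ?q B0"]) (use B0 e in \<open>auto intro!: EQ_row\<close>)
    qed
    \<comment> \<open>The row operation leaves row \<open>b\<close> unchanged and the column
      operation leaves column \<open>b\<close> unchanged, so the quotients of \<open>B\<close> serve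
      for both.\<close>
    define q1 where "q1 = (\<lambda>i. if i \<in> S then 0 else - (B $ i $ b div B $ b $ b))"
    define q2 where "q2 = (\<lambda>i. if i \<in> S then 0 else - (B $ b $ i div B $ b $ b))"
    define C where "C = col_op b q2 (row_op b q1 B)"
    have CEQ: "C \<in> EQ" unfolding C_def
      by (intro EQ_col EQ_row) (use B B0 in \<open>auto simp: q1_def q2_def\<close>)
    have R: "row_op b q1 B $ i $ b = 0" if "i \<noteq> b" for i
    proof (cases "i \<in> S")
      case True then show ?thesis using EQ_row[of B b q1] B B0 that unfolding EQ_def split_off_def q1_def by auto
    next
      case False
      then show ?thesis using that dvd_col[of B b b i] B B0 by (simp add: row_op_def q1_def)
    qed
    have Cb: "C $ i $ b = 0" if "i \<noteq> b" for i
      using R[OF that] by (simp add: C_def col_op_def)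
    have Cr: "C $ b $ i = 0" if "i \<noteq> b" for i
    proof (cases "i \<in> S")
      case True then show ?thesis using CEQ that unfolding EQ_def split_off_def by auto
    next
      case False
      then show ?thesis using that dvd_row[of B b b i] B B0
        by (simp add: C_def col_op_def row_op_def q2_def)
    qed
    have sp: "split_off (insert b S) C"
      using CEQ Cb Cr unfolding EQ_def split_off_def by auto
    have "card (UNIV - insert b S) < card (UNIV - S)"
      using B0(3) by (intro psubset_card_mono) auto
    from less.hyps[OF this sp] obtain D where
      D: "unimod_equiv C D" "\<forall>i j. i \<noteq> j \<longrightarrow> D $ i $ j = 0" by blast
    have "unimod_equiv A D"
      using CEQ D(1) by (intro unimod_equiv_trans[of A C D]) (simp_all add: EQ_def)
    with D(2) show ?thesis by blast
  qed
qed

text \<open>Unlike in the Smith normal form, the entries \<open>d i\<close> form no divisibility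
  chain: only the number of entries of each \<open>p\<close>-adic valuation matters later. The
  inverses are named because divisibility arguments move between the coordinate systems they
  define.\<close>

lemma int_matrix_diagonalize:
  fixes A :: "int^'n::finite^'n"
  obtains P P' Q Q' :: "int^'n^'n" and d where
    "P ** P' = mat 1" "P' ** P = mat 1" "Q ** Q' = mat 1" "Q' ** Q = mat 1"
    "P ** A ** Q = (\<chi> i j. if i = j then d i else 0)"
proof -
  obtain B where B: "unimod_equiv A B" "\<forall>i j. i \<noteq> j \<longrightarrow> B $ i $ j = 0"
    using unimod_equiv_diagonal_aux[of "{}" A] by (auto simp: split_off_def)
  then obtain P Q where PQ: "invertible P" "invertible Q" "B = P ** A ** Q"
    unfolding unimod_equiv_def by blast
  obtain P' Q' where "P ** P' = mat 1" "P' ** P = mat 1" "Q ** Q' = mat 1" "Q' ** Q = mat 1"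
    using PQ(1,2) unfolding invertible_def by blast
  moreover have "P ** A ** Q = (\<chi> i j. if i = j then B $ i $ i else 0)"
    using B PQ(3) by (auto simp: vec_eq_iff)
  ultimately show ?thesis
    by (rule that)
qed

section \<open>Primitive integral solutions of linear systems\<close>

definition real_vec :: "int^'n \<Rightarrow> real^'n" where
  "real_vec x = (\<chi> i. real_of_int (x $ i))"

lemma real_mat_mult: "real_mat (A ** B) = real_mat A ** real_mat (B :: int^'n::finite^'m::finite)"
  by (simp add: real_mat_def matrix_matrix_mult_def vec_eq_iff)

lemma real_mat_mat: "real_mat (mat c :: int^'n^'n) = mat (real_of_int c)"
  by (simp add: real_mat_def mat_def vec_eq_iff)

lemma real_mat_diff: "real_mat (A - B) = real_mat A - real_mat B"
  by (simp add: real_mat_def vec_eq_iff)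

lemma real_mat_mult_vec: "real_mat A *v real_vec x = real_vec (A *v (x :: int^'n::finite))"
  by (simp add: real_mat_def real_vec_def matrix_vector_mult_def vec_eq_iff)

lemma dvd_matrix_vector_mult:
  fixes A :: "int^'n::finite^'m"
  assumes "\<And>i. c dvd x $ i"
  shows "c dvd (A *v x) $ j"
  using assms by (auto simp: matrix_vector_mult_def intro!: dvd_sum)

lemma diagonal_mult_vec:
  fixes x :: "'a::semiring_1^'n::finite"
  shows "(\<chi> i j. if i = j then d i else 0) *v x = (\<chi> i. d i * x $ i)"
  by (simp add: matrix_vector_mult_def vec_eq_iff if_distrib[of "\<lambda>y. y * _"] cong: if_cong)

text \<open>The orthogonal complement of \<open>F\<close> has codimension at most
  \<open>card F < dim W\<close>, so it meets \<open>W\<close> nontrivially.\<close>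

lemma exists_nonzero_orthogonal:
  fixes W F :: "(real^'n::finite) set"
  assumes W: "subspace W" and F: "finite F" "card F < dim W"
  shows "\<exists>x\<in>W. x \<noteq> 0 \<and> (\<forall>a\<in>F. a \<bullet> x = 0)"
proof -
  define U where "U = {y \<in> UNIV. \<forall>x\<in>span F. orthogonal x y}"
  have "dim U + dim (span F) = dim (UNIV :: (real^'n) set)"
    unfolding U_def by (rule dim_subspace_orthogonal_to_vectors) auto
  moreover have "dim (span F) \<le> card F"
    using dim_le_card'[OF F(1)] by simp
  moreover have "subspace U"
    unfolding U_def using subspace_orthogonal_to_vectors[of "span F"] by simp
  then have "dim {x + y |x y. x \<in> W \<and> y \<in> U} + dim (W \<inter> U) = dim W + dim U"
    by (rule dim_sums_Int[OF W])
  moreover have "dim {x + y |x y. x \<in> W \<and> y \<in> U} \<le> dim (UNIV :: (real^'n) set)"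
    by (rule dim_subset) simp
  ultimately have "dim (W \<inter> U) \<noteq> 0" using F(2) by linarith
  then obtain x where "x \<in> W \<inter> U" "x \<noteq> 0" by (auto simp: dim_eq_0)
  moreover then have "\<forall>a\<in>F. a \<bullet> x = 0"
    by (auto simp: U_def orthogonal_def span_base)
  ultimately show ?thesis by blast
qed

text \<open>The general ring and the family \<open>h\<close> let the formula apply both to the
  integral matrix and to its real image, where \<open>h\<close> is \<open>real_vec\<close>.\<close>

lemma gram_mult_vec:
  fixes M :: "'a::comm_ring_1^'n::finite^'n" and h :: "'b \<Rightarrow> 'a^'n"
  shows "(transpose M ** M + (\<chi> i j. \<Sum>a\<in>F. h a $ i * h a $ j)) *v x
    = transpose M *v (M *v x) + (\<chi> i. \<Sum>a\<in>F. h a $ i * (\<Sum>j\<in>UNIV. h a $ j * x $ j))"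
proof -
  have "(\<chi> i j. \<Sum>a\<in>F. h a $ i * h a $ j) *v x
    = (\<chi> i. \<Sum>a\<in>F. h a $ i * (\<Sum>j\<in>UNIV. h a $ j * x $ j))"
    by (simp add: matrix_vector_mult_def vec_eq_iff sum_distrib_left sum_distrib_right
        sum.swap[of _ F] mult.assoc)
  then show ?thesis
    by (simp add: matrix_vector_mult_add_rdistrib matrix_vector_mul_assoc)
qed

text \<open>Pairing the product with \<open>x\<close> gives the squared length of
  \<open>M *v x\<close> plus the squares of the products of \<open>x\<close> with each
  \<open>a\<close> in \<open>F\<close>. A vanishing sum of squares has vanishing terms, so one
  matrix encodes all the equations.\<close>

lemma gram_kernel_int:
  fixes M :: "int^'n::finite^'n"
  assumes "finite F"
    and 0: "(transpose M ** M + (\<chi> i j. \<Sum>a\<in>F. a $ i * a $ j)) *v x = 0"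
  shows "M *v x = 0" "\<forall>a\<in>F. (\<Sum>j\<in>UNIV. a $ j * x $ j) = 0"
proof -
  let ?d = "\<lambda>a. \<Sum>j\<in>UNIV. a $ j * x $ j"
  have *: "transpose M *v (M *v x) + (\<chi> i. \<Sum>a\<in>F. a $ i * ?d a) = 0"
    using 0 unfolding gram_mult_vec[of M "\<lambda>a. a" F x] .
  have "(\<Sum>i\<in>UNIV. x $ i * (transpose M *v (M *v x)) $ i)
     = (\<Sum>i\<in>UNIV. \<Sum>k\<in>UNIV. (M *v x) $ k * (M $ k $ i * x $ i))"
    by (simp add: vector_matrix_mult_def sum_distrib_left mult_ac)
  also have "\<dots> = (\<Sum>k\<in>UNIV. (M *v x) $ k * (\<Sum>i\<in>UNIV. M $ k $ i * x $ i))"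
    by (subst sum.swap) (simp add: sum_distrib_left)
  finally have 1: "(\<Sum>i\<in>UNIV. x $ i * (transpose M *v (M *v x)) $ i) = (\<Sum>k\<in>UNIV. ((M *v x) $ k)\<^sup>2)"
    by (simp add: matrix_vector_mult_def[where m = M] power2_eq_square)
  have "(\<Sum>i\<in>UNIV. x $ i * (\<Sum>a\<in>F. a $ i * ?d a)) = (\<Sum>i\<in>UNIV. \<Sum>a\<in>F. ?d a * (a $ i * x $ i))"
    by (simp add: sum_distrib_left mult_ac)
  also have "\<dots> = (\<Sum>a\<in>F. ?d a * ?d a)"
    by (subst sum.swap) (simp add: sum_distrib_left)
  finally have 2: "(\<Sum>i\<in>UNIV. x $ i * (\<Sum>a\<in>F. a $ i * ?d a)) = (\<Sum>a\<in>F. (?d a)\<^sup>2)"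
    by (simp add: power2_eq_square)
  have "(\<Sum>i\<in>UNIV. x $ i * (transpose M *v (M *v x) + (\<chi> i. \<Sum>a\<in>F. a $ i * ?d a)) $ i) = 0"
    unfolding * by simp
  then have "(\<Sum>k\<in>UNIV. ((M *v x) $ k)\<^sup>2) + (\<Sum>a\<in>F. (?d a)\<^sup>2) = 0"
    by (simp add: distrib_left sum.distrib 1 2 del: transpose_matrix_vector)
  moreover have "(\<Sum>k\<in>UNIV. ((M *v x) $ k)\<^sup>2) \<ge> 0" "(\<Sum>a\<in>F. (?d a)\<^sup>2) \<ge> 0"
    by (simp_all add: sum_nonneg)
  ultimately have "(\<Sum>k\<in>UNIV. ((M *v x) $ k)\<^sup>2) = 0" "(\<Sum>a\<in>F. (?d a)\<^sup>2) = 0"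
    by linarith+
  then show "M *v x = 0" "\<forall>a\<in>F. ?d a = 0"
    using assms(1) by (simp_all add: sum_nonneg_eq_0_iff vec_eq_iff)
qed

text \<open>The real solutions form the kernel of the integral positive semidefinite matrix
  \<open>M\<^sup>T M + \<Sum>a. a a\<^sup>T\<close>; diagonalising it over the integers turns a real
  kernel vector into a column of a unimodular matrix.\<close>
lemma exists_primitive_int_solution:
  fixes M :: "int^'n::finite^'n" and c :: int
  assumes F: "finite F" "card F < dim {x. real_mat M *v x = 0}" and c: "\<not> is_unit c"
  shows "\<exists>x. M *v x = 0 \<and> (\<forall>a\<in>F. (\<Sum>j\<in>UNIV. a $ j * x $ j) = 0) \<and> (\<exists>i. \<not> c dvd x $ i)"
proof -
  define G where "G = transpose M ** M + (\<chi> i j. \<Sum>a\<in>F. a $ i * a $ j)"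
  have "subspace {x. real_mat M *v x = 0}"
    by (auto intro!: subspaceI simp: matrix_vector_right_distrib matrix_vector_mult_scaleR)
  moreover have "finite (real_vec ` F)" "card (real_vec ` F) < dim {x. real_mat M *v x = 0}"
    using F card_image_le[OF F(1), of real_vec] by auto
  ultimately have "\<exists>x\<in>{x. real_mat M *v x = 0}. x \<noteq> 0 \<and> (\<forall>a\<in>real_vec ` F. a \<bullet> x = 0)"
    by (rule exists_nonzero_orthogonal)
  then obtain x0 where x0: "real_mat M *v x0 = 0" "x0 \<noteq> 0" "\<forall>a\<in>F. real_vec a \<bullet> x0 = 0"
    by auto
  have rG: "real_mat G = transpose (real_mat M) ** real_mat M
      + (\<chi> i j. \<Sum>a\<in>F. real_vec a $ i * real_vec a $ j)"
    by (simp add: G_def real_mat_def real_vec_def transpose_def matrix_matrix_mult_def vec_eq_iff)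
  have Gx0: "real_mat G *v x0 = 0"
    unfolding rG gram_mult_vec x0(1) using x0(3) by (simp add: inner_vec_def vec_eq_iff)
  obtain P P' Q Q' :: "int^'n^'n" and d where
    PQ: "P ** P' = mat 1" "P' ** P = mat 1" "Q ** Q' = mat 1" "Q' ** Q = mat 1"
    and D: "P ** G ** Q = (\<chi> i j. if i = j then d i else 0)"
    by (rule int_matrix_diagonalize)
  \<comment> \<open>With all \<open>d i\<close> nonzero, the real image of \<open>G\<close> would be
    injective, contrary to \<open>x0\<close>.\<close>
  have "\<exists>i. d i = 0"
  proof (rule ccontr)
    assume nz: "\<nexists>i. d i = 0"
    define y where "y = real_mat Q' *v x0"
    have Qy: "real_mat Q *v y = x0"
      using PQ(3) real_mat_mat[of 1, where 'n='n]
      by (simp add: y_def matrix_vector_mul_assoc flip: real_mat_mult)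
    have "real_mat (P ** G ** Q) *v y = real_mat P *v (real_mat G *v (real_mat Q *v y))"
      by (simp add: real_mat_mult matrix_vector_mul_assoc matrix_mul_assoc)
    also have "\<dots> = 0" by (simp add: Qy Gx0)
    finally have "real_mat (P ** G ** Q) *v y = 0" .
    moreover have "real_mat (P ** G ** Q) = (\<chi> i j. if i = j then real_of_int (d i) else 0)"
      unfolding D by (simp add: real_mat_def vec_eq_iff)
    ultimately have "y = 0" using nz by (simp add: diagonal_mult_vec vec_eq_iff)
    then show False using Qy x0(2) by simp
  qed
  then obtain i where i: "d i = 0" by blast
  define x where "x = Q *v axis i 1"
  have "P *v (G *v x) = 0"
    unfolding x_def matrix_vector_mul_assoc matrix_mul_assoc D diagonal_mult_vec
    using i by (simp add: vec_eq_iff axis_def)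
  then have "P' *v (P *v (G *v x)) = 0" by simp
  then have "G *v x = 0" by (simp add: matrix_vector_mul_assoc matrix_mul_assoc PQ)
  then have "M *v x = 0" "\<forall>a\<in>F. (\<Sum>j\<in>UNIV. a $ j * x $ j) = 0"
    using gram_kernel_int[OF F(1)] unfolding G_def by blast+
  moreover have "\<exists>i. \<not> c dvd x $ i"
  proof (rule ccontr)
    assume "\<nexists>i. \<not> c dvd x $ i"
    \<comment> \<open>Coordinate \<open>i\<close> of \<open>Q' *v x\<close> is 1, since
      \<open>x\<close> is column \<open>i\<close> of \<open>Q\<close>.\<close>
    then have "c dvd (Q' *v x) $ i" by (intro dvd_matrix_vector_mult) auto
    then show False using c by (simp add: x_def matrix_vector_mul_assoc PQ axis_def)
  qed
  ultimately show ?thesis by blast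
qed

lemma exists_primitive_int_vector:
  fixes F :: "(int^'n::finite) set" and c :: int
  assumes "finite F" "card F < CARD('n)" "\<not> is_unit c"
  shows "\<exists>x. (\<forall>a\<in>F. (\<Sum>j\<in>UNIV. a $ j * x $ j) = 0) \<and> (\<exists>i. \<not> c dvd x $ i)"
proof -
  have "{x. real_mat (0::int^'n^'n) *v x = 0} = UNIV"
    by (auto simp: real_mat_def matrix_vector_mult_def vec_eq_iff)
  then have "dim {x. real_mat (0::int^'n^'n) *v x = 0} = CARD('n)"
    by simp
  then show ?thesis using exists_primitive_int_solution[of F 0 c] assms by auto
qed

section \<open>The rank modulo a prime\<close>

locale int_diagonalization =
  fixes A P P' Q Q' :: "int^'n::finite^'n" and d :: "'n \<Rightarrow> int"
  assumes PP': "P ** P' = mat 1" and P'P: "P' ** P = mat 1"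
    and QQ': "Q ** Q' = mat 1" and Q'Q: "Q' ** Q = mat 1"
    and diag: "P ** A ** Q = (\<chi> i j. if i = j then d i else 0)"
begin

section \<open>Coordinates in which the matrix is diagonal\<close>

lemma P_mult_A: "P ** A = (\<chi> i j. if i = j then d i else 0) ** Q'"
proof -
  have "P ** A ** Q ** Q' = P ** A"
    by (simp add: QQ' flip: matrix_mul_assoc)
  then show ?thesis by (simp add: diag)
qed

lemma A_mult_Q: "A ** Q = P' ** (\<chi> i j. if i = j then d i else 0)"
proof -
  have "P' ** (P ** A ** Q) = A ** Q"
    by (simp add: P'P matrix_mul_assoc)
  then show ?thesis by (simp add: diag)
qed

lemma P_mult_A_vec: "(P *v (A *v x)) $ i = d i * (Q' *v x) $ i"
proof -
  have "P *v (A *v x) = (\<chi> i j. if i = j then d i else 0) *v (Q' *v x)"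
    by (simp only: matrix_vector_mul_assoc P_mult_A)
  then show ?thesis by (simp add: diagonal_mult_vec)
qed

lemma P'_P_vec: "P' *v (P *v x) = x"
  by (simp add: matrix_vector_mul_assoc P'P)

lemma P_P'_vec: "P *v (P' *v x) = x"
  by (simp add: matrix_vector_mul_assoc PP')

lemma Q_Q'_vec: "Q *v (Q' *v x) = x"
  by (simp add: matrix_vector_mul_assoc QQ')

lemma vec_A_mult_Q: "((x v* A) v* Q) $ i = (x v* P') $ i * d i"
proof -
  have "(x v* A) v* Q = (x v* P') v* (\<chi> i j. if i = j then d i else 0)"
    by (simp add: vector_matrix_mul_assoc A_mult_Q)
  moreover have "(y v* (\<chi> i j. if i = j then d i else 0)) $ i = y $ i * d i" for y
    by (simp add: vector_matrix_mult_def if_distrib[of "\<lambda>z. _ * z"] cong: if_cong)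
  ultimately show ?thesis by simp
qed

text \<open>An integral matrix preserves common divisors of coordinates, and so does its integral
  inverse. Hence primitivity modulo \<open>p\<close> can be tested in the coordinates given by
  \<open>P\<close>, and likewise by \<open>Q'\<close>.\<close>

lemma all_dvd_P_iff: "(\<forall>i. c dvd (P *v x) $ i) \<longleftrightarrow> (\<forall>i. c dvd x $ i)"
  using dvd_matrix_vector_mult[of c "P *v x" P'] dvd_matrix_vector_mult[of c x P]
  by (auto simp: P'_P_vec)

lemma all_dvd_Q'_iff: "(\<forall>i. c dvd (Q' *v x) $ i) \<longleftrightarrow> (\<forall>i. c dvd x $ i)"
  using dvd_matrix_vector_mult[of c "Q' *v x" Q] dvd_matrix_vector_mult[of c x Q']
  by (auto simp: Q_Q'_vec)

text \<open>A relation modulo \<open>c\<close> between the rows of \<open>A\<close> becomes, in the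
  coordinates \<open>x v* P'\<close>, one separate condition for each diagonal entry.\<close>

lemma all_dvd_vec_A_iff:
  "(\<forall>j. c dvd (x v* A) $ j) \<longleftrightarrow> (\<forall>i. c dvd (x v* P') $ i * d i)"
proof
  assume "\<forall>j. c dvd (x v* A) $ j"
  then have "c dvd ((x v* A) v* Q) $ i" for i
    by (auto simp: vector_matrix_mult_def[where m = Q] intro!: dvd_sum dvd_mult2)
  then show "\<forall>i. c dvd (x v* P') $ i * d i" by (simp add: vec_A_mult_Q)
next
  assume "\<forall>i. c dvd (x v* P') $ i * d i"
  then have "c dvd ((x v* A) v* Q) $ i" for i by (simp add: vec_A_mult_Q)
  then have "c dvd (((x v* A) v* Q) v* Q') $ i" for i
    by (auto simp: vector_matrix_mult_def[where m = Q'] intro!: dvd_sum dvd_mult2)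
  moreover have "((x v* A) v* Q) v* Q' = x v* A"
    by (simp add: vector_matrix_mul_assoc QQ' flip: matrix_mul_assoc)
  ultimately show "\<forall>j. c dvd (x v* A) $ j" by simp
qed

text \<open>Both inequalities use that fewer homogeneous integral equations than unknowns
  have a solution that is nonzero modulo \<open>p\<close>.\<close>
lemma p_rank_eq_card:
  assumes p: "Factorial_Ring.prime p"
  shows "p_rank p A = card {i. \<not> int p dvd d i}"
proof -
  define U where "U = {i. \<not> int p dvd d i}"
  define ind where "ind = (\<lambda>S. \<forall>c :: 'n \<Rightarrow> int.
       (\<forall>j. int p dvd (\<Sum>i\<in>S. c i * A $ i $ j)) \<longrightarrow> (\<forall>i\<in>S. int p dvd c i))"
  have pp: "Factorial_Ring.prime (int p)" and nu: "\<not> is_unit (int p)"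
    using p by (auto simp: not_prime_unit)
  have upper: "card S \<le> card U" if S: "ind S" for S
  proof (rule ccontr)
    assume less: "\<not> card S \<le> card U"
    \<comment> \<open>A solution \<open>c\<close> is supported on \<open>S\<close>, and
      \<open>c v* P'\<close> vanishes on \<open>U\<close>. It is thus a relation modulo
      \<open>p\<close> between the rows in \<open>S\<close>, nontrivial since \<open>c\<close> is
      primitive.\<close>
    define F :: "(int^'n) set" where "F = (\<lambda>i. axis i 1) ` (UNIV - S) \<union> (\<lambda>i. column i P') ` U"
    have "card F \<le> card (UNIV - S) + card U"
      unfolding F_def by (intro card_Un_le[THEN order_trans] add_mono card_image_le) auto
    moreover have "card (UNIV - S) = CARD('n) - card S" "card S \<le> CARD('n)"
      by (simp_all add: card_Diff_subset card_mono)
    ultimately have "card F < CARD('n)" using less by linarith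
    then obtain c where c: "\<forall>a\<in>F. (\<Sum>j\<in>UNIV. a $ j * c $ j) = 0" "\<exists>i. \<not> int p dvd c $ i"
      using exists_primitive_int_vector[of F "int p"] nu by (auto simp: F_def)
    have c0: "c $ i = 0" if "i \<notin> S" for i
    proof -
      have "(\<Sum>j\<in>UNIV. (axis i 1 :: int^'n) $ j * c $ j) = 0" using c(1) that by (auto simp: F_def)
      then show ?thesis by (simp add: axis_def if_distrib[of "\<lambda>y. y * _"] cong: if_cong)
    qed
    have cP: "(c v* P') $ i = 0" if "i \<in> U" for i
    proof -
      have "(\<Sum>j\<in>UNIV. column i P' $ j * c $ j) = 0" using c(1) that by (auto simp: F_def)
      then show ?thesis by (simp add: column_def vector_matrix_mult_def mult.commute)
    qed
    have "int p dvd (c v* P') $ i * d i" for i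
      using cP[of i] by (cases "i \<in> U") (auto simp: U_def)
    then have "int p dvd (c v* A) $ j" for j
      using all_dvd_vec_A_iff[of "int p" c] by blast
    moreover have "(c v* A) $ j = (\<Sum>i\<in>S. c $ i * A $ i $ j)" for j
      unfolding vector_matrix_mult_def by (simp, rule sum.mono_neutral_right) (auto simp: c0)
    ultimately have "\<forall>i\<in>S. int p dvd c $ i" using S unfolding ind_def by metis
    then have "int p dvd c $ i" for i using c0[of i] by (cases "i \<in> S") auto
    then show False using c(2) by blast
  qed
  have pr: "p_rank p A = Max {card S |S. ind S}"
    unfolding p_rank_def ind_def ..
  have fin: "finite {card S |S. ind S}" by simp
  have "ind {}" by (simp add: ind_def)
  then have "{card S |S. ind S} \<noteq> {}" by blast
  from Max_in[OF fin this] obtain S where S: "ind S" "p_rank p A = card S"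
    unfolding pr by blast
  have max: "card S' \<le> card S" if "ind S'" for S'
    using Max_ge[OF fin, of "card S'"] that S(2) unfolding pr by auto
  have "card U \<le> card S"
  proof (rule ccontr)
    assume less: "\<not> card U \<le> card S"
    \<comment> \<open>The equations annihilate \<open>A *v y\<close> on \<open>S\<close> and
      \<open>Q' *v y\<close> outside \<open>U\<close>. The aim is to show that \<open>p\<close>
      divides \<open>A *v y\<close>, and then also \<open>Q' *v y\<close> on
      \<open>U\<close>.\<close>
    define F :: "(int^'n) set" where "F = (\<lambda>i. A $ i) ` S \<union> (\<lambda>i. Q' $ i) ` (UNIV - U)"
    have "card F \<le> card S + card (UNIV - U)"
      unfolding F_def by (intro card_Un_le[THEN order_trans] add_mono card_image_le) auto
    moreover have "card (UNIV - U) = CARD('n) - card U" "card U \<le> CARD('n)"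
      by (simp_all add: card_Diff_subset card_mono)
    ultimately have "card F < CARD('n)" using less by linarith
    then obtain y where y: "\<forall>a\<in>F. (\<Sum>j\<in>UNIV. a $ j * y $ j) = 0" "\<exists>i. \<not> int p dvd y $ i"
      using exists_primitive_int_vector[of F "int p"] nu by (auto simp: F_def)
    have AyS: "(A *v y) $ i = 0" if "i \<in> S" for i
      using y(1) that by (auto simp: F_def matrix_vector_mult_def)
    have QyU: "(Q' *v y) $ i = 0" if "i \<notin> U" for i
      using y(1) that by (auto simp: F_def matrix_vector_mult_def)
    have Ay: "int p dvd (A *v y) $ j" for j
    proof (cases "j \<in> S")
      case True then show ?thesis by (simp add: AyS)
    next
      case False
      \<comment> \<open>By maximality of \<open>S\<close> there is a relation modulo
        \<open>p\<close> that involves row \<open>j\<close>; its coefficient there is prime to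
        \<open>p\<close> because \<open>S\<close> itself is independent.\<close>
      then have "\<not> ind (insert j S)"
        using max[of "insert j S"] by auto
      then obtain c i0 where c: "\<forall>k. int p dvd (\<Sum>i\<in>insert j S. c i * A $ i $ k)"
        and i0: "i0 \<in> insert j S" "\<not> int p dvd c i0"
        unfolding ind_def by blast
      have cj: "\<not> int p dvd c j"
      proof
        assume cj: "int p dvd c j"
        have "int p dvd (\<Sum>i\<in>S. c i * A $ i $ k)" for k
          using c[rule_format, of k] False cj by (simp add: dvd_add_right_iff)
        then have "\<forall>i\<in>S. int p dvd c i" using S(1) unfolding ind_def by blast
        then show False using i0 cj by auto
      qed
      have "int p dvd (\<Sum>k\<in>UNIV. (\<Sum>i\<in>insert j S. c i * A $ i $ k) * y $ k)"
        using c by (intro ballI dvd_sum[where A = UNIV] dvd_mult2) blast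
      also have "(\<Sum>k\<in>UNIV. (\<Sum>i\<in>insert j S. c i * A $ i $ k) * y $ k)
        = (\<Sum>i\<in>insert j S. c i * (A *v y) $ i)"
        unfolding sum_distrib_right matrix_vector_mult_def
        by (subst sum.swap) (simp add: sum_distrib_left mult.assoc)
      also have "\<dots> = c j * (A *v y) $ j"
        using False by (simp add: AyS)
      finally show ?thesis using cj pp by (simp add: prime_dvd_mult_iff)
    qed
    have "int p dvd (Q' *v y) $ i" for i
    proof (cases "i \<in> U")
      case True
      have "int p dvd (P *v (A *v y)) $ i" using Ay by (rule dvd_matrix_vector_mult)
      then show ?thesis using True pp by (simp add: P_mult_A_vec prime_dvd_mult_iff U_def)
    qed (simp add: QyU)
    then show False using all_dvd_Q'_iff y(2) by blast
  qed
  with upper[OF S(1)] S(2) show ?thesis by (simp add: U_def)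
qed

end

section \<open>The Sylow subgroup of a cokernel\<close>

lemma comm_group_lattice_group: "comm_group (lattice_group :: (int^'n) monoid)"
proof (rule comm_groupI)
  fix x :: "int^'n"
  show "\<exists>y\<in>carrier lattice_group. y \<otimes>\<^bsub>lattice_group\<^esub> x = \<one>\<^bsub>lattice_group\<^esub>"
    by (rule bexI[of _ "- x"]) (simp_all add: lattice_group_def)
qed (simp_all add: lattice_group_def add_ac)

lemma carrier_lattice_group: "carrier lattice_group = UNIV"
  by (simp add: lattice_group_def)

lemma lattice_group_pow: "(x :: int^'n) [^]\<^bsub>lattice_group\<^esub> (n::nat) = int n *s x"
proof -
  interpret comm_group "lattice_group :: (int^'n) monoid" by (rule comm_group_lattice_group)
  show ?thesis
    by (induction n) (simp_all add: lattice_group_def vec_eq_iff algebra_simps)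
qed

lemma subgroup_range_mult_vec: "subgroup (range (\<lambda>x. A *v x)) (lattice_group :: (int^'n::finite) monoid)"
proof -
  interpret G: comm_group "lattice_group :: (int^'n) monoid" by (rule comm_group_lattice_group)
  show ?thesis
  proof (rule G.subgroupI)
    fix a :: "int^'n" assume "a \<in> range (\<lambda>x. A *v x)"
    then obtain x where x: "a = A *v x" by blast
    have "inv\<^bsub>lattice_group\<^esub> a = - a"
      by (rule G.inv_equality) (simp_all add: lattice_group_def)
    also have "\<dots> = A *v (- x)" by (simp add: x matrix_vector_mult_def vec_eq_iff sum_negf)
    finally show "inv\<^bsub>lattice_group\<^esub> a \<in> range (\<lambda>x. A *v x)" by blast
  next
    fix a b :: "int^'n" assume "a \<in> range (\<lambda>x. A *v x)" "b \<in> range (\<lambda>x. A *v x)"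
    then show "a \<otimes>\<^bsub>lattice_group\<^esub> b \<in> range (\<lambda>x. A *v x)"
      by (auto simp: lattice_group_def simp flip: matrix_vector_right_distrib)
  qed (simp_all add: carrier_lattice_group)
qed

lemma cokernel_pow_eq_one_iff:
  fixes A :: "int^'n::finite^'n"
  defines "N \<equiv> range (\<lambda>x. A *v x)"
  shows "(N #>\<^bsub>lattice_group\<^esub> x) [^]\<^bsub>cokernel A\<^esub> (n::nat) = \<one>\<^bsub>cokernel A\<^esub> \<longleftrightarrow> int n *s x \<in> N"
proof -
  interpret G: comm_group "lattice_group :: (int^'n) monoid" by (rule comm_group_lattice_group)
  have sub: "subgroup N lattice_group" unfolding N_def by (rule subgroup_range_mult_vec)
  then interpret normal N "lattice_group :: (int^'n) monoid"
    by (rule G.subgroup_imp_normal)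
  have C: "cokernel A = lattice_group Mod N" by (simp add: cokernel_def N_def)
  have "N #>\<^bsub>lattice_group\<^esub> (x [^]\<^bsub>lattice_group\<^esub> n) = (N #>\<^bsub>lattice_group\<^esub> x) [^]\<^bsub>lattice_group Mod N\<^esub> n"
    using r_coset_hom_Mod G.is_group factorgroup_is_group
    by (intro hom_nat_pow) (auto simp: carrier_lattice_group)
  then have "(N #>\<^bsub>lattice_group\<^esub> x) [^]\<^bsub>cokernel A\<^esub> n = \<one>\<^bsub>cokernel A\<^esub>
      \<longleftrightarrow> N #>\<^bsub>lattice_group\<^esub> (int n *s x) = N"
    by (simp add: C lattice_group_pow)
  also have "\<dots> \<longleftrightarrow> int n *s x \<in> N"
    using G.coset_join1[OF _ _ sub] G.coset_join2[OF _ sub] by (auto simp: carrier_lattice_group)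
  finally show ?thesis .
qed

text \<open>This is the passage from the cokernel to \<open>critical_group\<close>, separated from
  graphs so that the computation covers any integral matrix.\<close>

definition torsion_part :: "('a, 'b) monoid_scheme \<Rightarrow> ('a, 'b) monoid_scheme" where
  "torsion_part G = G\<lparr>carrier := {a \<in> carrier G. \<exists>n::nat. n > 0 \<and> a [^]\<^bsub>G\<^esub> n = \<one>\<^bsub>G\<^esub>}\<rparr>"

lemma critical_group_eq_torsion_part: "critical_group E k = torsion_part (cokernel (laplacian E k))"
  by (simp add: critical_group_def torsion_part_def Let_def)

text \<open>The preimage in the lattice of the \<open>p\<close>-primary part of the
  cokernel.\<close>

definition p_saturation :: "nat \<Rightarrow> int^'n::finite^'n \<Rightarrow> (int^'n) set" where
  "p_saturation p A = {x. \<exists>e. int (p ^ e) *s x \<in> range (\<lambda>x. A *v x)}"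

text \<open>A class killed by a power of \<open>p > 0\<close> is already torsion, so both
  restrictions together select the cosets of points of \<open>p_saturation p A\<close>.
  Multiplication of cosets is the same set product on both sides, hence an equality and not only an
  isomorphism.\<close>

lemma sylow_torsion_cokernel:
  fixes A :: "int^'n::finite^'n"
  assumes "p > 0"
  shows "sylow_part p (torsion_part (cokernel A))
    = (lattice_group\<lparr>carrier := p_saturation p A\<rparr>) Mod range (\<lambda>x. A *v x)"
proof -
  define N where "N = range (\<lambda>x. A *v x)"
  define C where "C = cokernel A"
  have car: "carrier C = (\<lambda>x. N #>\<^bsub>lattice_group\<^esub> x) ` UNIV"
    by (simp add: C_def cokernel_def N_def carrier_FactGroup carrier_lattice_group)
  have pow: "a [^]\<^bsub>G\<lparr>carrier := S\<rparr>\<^esub> (n::nat) = a [^]\<^bsub>G\<^esub> n" for a :: "(int^'n) set" and G S n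
    by (simp add: nat_pow_def)
  have iff: "(N #>\<^bsub>lattice_group\<^esub> x) [^]\<^bsub>C\<^esub> n = \<one>\<^bsub>C\<^esub> \<longleftrightarrow> int n *s x \<in> N" for x and n :: nat
    unfolding C_def N_def by (rule cokernel_pow_eq_one_iff)
  have carS: "carrier (sylow_part p (torsion_part C)) = (\<lambda>x. N #>\<^bsub>lattice_group\<^esub> x) ` p_saturation p A"
    (is "?L = ?R")
  proof
    show "?L \<subseteq> ?R"
    proof
      fix a assume a: "a \<in> ?L"
      then obtain x where x: "a = N #>\<^bsub>lattice_group\<^esub> x"
        by (auto simp: sylow_part_def torsion_part_def car)
      moreover have "\<exists>e::nat. a [^]\<^bsub>C\<^esub> (p ^ e) = \<one>\<^bsub>C\<^esub>"
        using a by (auto simp: sylow_part_def torsion_part_def pow)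
      ultimately have "x \<in> p_saturation p A"
        unfolding p_saturation_def N_def[symmetric] using iff by blast
      with x show "a \<in> ?R" by blast
    qed
    show "?R \<subseteq> ?L"
    proof
      fix a assume "a \<in> ?R"
      then obtain x e where x: "a = N #>\<^bsub>lattice_group\<^esub> x" "int (p ^ e) *s x \<in> N"
        by (auto simp: p_saturation_def N_def)
      then have *: "a [^]\<^bsub>C\<^esub> (p ^ e) = \<one>\<^bsub>C\<^esub>" using iff by blast
      moreover have "p ^ e > 0" using assms by simp
      ultimately have "\<exists>n::nat. n > 0 \<and> a [^]\<^bsub>C\<^esub> n = \<one>\<^bsub>C\<^esub>" by blast
      moreover have "a \<in> carrier C" using x(1) car by blast
      ultimately show "a \<in> ?L"
        using * by (auto simp: sylow_part_def torsion_part_def pow)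
    qed
  qed
  have "sylow_part p (torsion_part C) = (lattice_group\<lparr>carrier := p_saturation p A\<rparr>) Mod N"
  proof (rule monoid.equality)
    show "carrier (sylow_part p (torsion_part C))
        = carrier ((lattice_group\<lparr>carrier := p_saturation p A\<rparr>) Mod N)"
      unfolding carS carrier_FactGroup by (simp add: r_coset_def)
    show "monoid.mult (sylow_part p (torsion_part C))
        = monoid.mult ((lattice_group\<lparr>carrier := p_saturation p A\<rparr>) Mod N)"
      by (simp add: sylow_part_def torsion_part_def C_def cokernel_def set_mult_def fun_eq_iff)
  qed (simp_all add: sylow_part_def torsion_part_def C_def cokernel_def N_def FactGroup_def)
  then show ?thesis by (simp only: C_def N_def)
qed

section \<open>The Sylow subgroup in diagonal coordinates\<close>

context int_diagonalization
begin

lemma range_A_iff: "x \<in> range (\<lambda>x. A *v x) \<longleftrightarrow> (\<forall>i. d i dvd (P *v x) $ i)"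
proof
  assume "x \<in> range (\<lambda>x. A *v x)"
  then show "\<forall>i. d i dvd (P *v x) $ i" by (auto simp: P_mult_A_vec)
next
  assume "\<forall>i. d i dvd (P *v x) $ i"
  then obtain y where y: "\<And>i. (P *v x) $ i = d i * y i" unfolding dvd_def by metis
  have "P *v (A *v (Q *v (\<chi> i. y i))) = P *v x"
    unfolding vec_eq_iff P_mult_A_vec by (simp add: matrix_vector_mul_assoc Q'Q y)
  then have "A *v (Q *v (\<chi> i. y i)) = x" by (metis P'_P_vec)
  then show "x \<in> range (\<lambda>x. A *v x)" by blast
qed

text \<open>The part of \<open>d i\<close> prime to \<open>p\<close>. For \<open>d i = 0\<close> it
  is 0, and divisibility by it then forces the coordinate to vanish, which removes the free
  summand.\<close>

definition cofactor :: "nat \<Rightarrow> 'n \<Rightarrow> int" where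
  "cofactor p i = d i div int p ^ multiplicity (int p) (d i)"

lemma d_eq_power_cofactor: "d i = int p ^ multiplicity (int p) (d i) * cofactor p i"
  by (simp add: cofactor_def multiplicity_dvd)

text \<open>Multiplying by a power of \<open>p\<close> can supply the \<open>p\<close>-part of each
  \<open>d i\<close> but contributes nothing to the part coprime to \<open>p\<close>.\<close>

lemma p_saturation_iff:
  assumes p: "Factorial_Ring.prime p"
  shows "x \<in> p_saturation p A \<longleftrightarrow> (\<forall>i. cofactor p i dvd (P *v x) $ i)"
proof -
  have scale: "(P *v (c *s x)) $ i = c * (P *v x) $ i" for c i
    by (simp add: matrix_vector_mult_def sum_distrib_left mult_ac)
  have sat: "x \<in> p_saturation p A \<longleftrightarrow> (\<exists>e. \<forall>i. d i dvd int p ^ e * (P *v x) $ i)"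
    unfolding p_saturation_def mem_Collect_eq range_A_iff scale by simp
  show ?thesis
  proof
    assume "x \<in> p_saturation p A"
    then obtain e where e: "\<And>i. d i dvd int p ^ e * (P *v x) $ i" using sat by blast
    show "\<forall>i. cofactor p i dvd (P *v x) $ i"
    proof
      fix i
      show "cofactor p i dvd (P *v x) $ i"
      proof (cases "d i = 0")
        case True
        then show ?thesis using e[of i] p by (auto simp: cofactor_def)
      next
        case False
        have pp: "Factorial_Ring.prime (int p)" using p by simp
        then have "\<not> int p dvd cofactor p i"
          unfolding cofactor_def using False by (intro multiplicity_decompose) (auto simp: not_prime_unit)
        then have "coprime (cofactor p i) (int p ^ e)"
          using pp by (metis coprime_commute coprime_power_left_iff prime_imp_coprime)
        moreover have "cofactor p i dvd int p ^ e * (P *v x) $ i"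
          using e[of i] d_eq_power_cofactor[of i p] by (metis dvd_mult_right)
        ultimately show ?thesis by (simp add: coprime_dvd_mult_right_iff)
      qed
    qed
  next
    assume c: "\<forall>i. cofactor p i dvd (P *v x) $ i"
    \<comment> \<open>The sum of the valuations is an exponent large enough for all coordinates at
      once.\<close>
    define e where "e = (\<Sum>i\<in>UNIV. multiplicity (int p) (d i))"
    have "d i dvd int p ^ e * (P *v x) $ i" for i
    proof -
      have "multiplicity (int p) (d i) \<le> e" unfolding e_def by (rule member_le_sum) auto
      then have "int p ^ multiplicity (int p) (d i) * cofactor p i dvd int p ^ e * (P *v x) $ i"
        using c by (intro mult_dvd_mono le_imp_power_dvd) auto
      then show ?thesis using d_eq_power_cofactor[of i p] by simp
    qed
    then show "x \<in> p_saturation p A" using sat by blast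
  qed
qed

text \<open>On \<open>p_saturation p A\<close> the quotient by the cofactor is exact, so its residue
  is additive. In use, \<open>h\<close> enumerates the indices of valuation \<open>m\<close>, and
  \<open>q\<close> is \<open>p ^ m\<close>.\<close>

definition residues_map :: "nat \<Rightarrow> nat \<Rightarrow> nat \<Rightarrow> (nat \<Rightarrow> 'n) \<Rightarrow> int^'n \<Rightarrow> nat \<Rightarrow> int" where
  "residues_map p q a h x = (\<lambda>j\<in>{..<a}. ((P *v x) $ h j div cofactor p (h j)) mod int q)"

lemma residues_map_hom:
  assumes p: "Factorial_Ring.prime p" and q: "q > 0"
  shows "residues_map p q a h \<in> hom (lattice_group\<lparr>carrier := p_saturation p A\<rparr>)
     (sum_group {..<a} (\<lambda>_. integer_mod_group q))"
proof (rule homI)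
  fix x :: "int^'n"
  show "residues_map p q a h x \<in> carrier (sum_group {..<a} (\<lambda>_. integer_mod_group q))"
    using q by (auto simp: carrier_sum_group carrier_integer_mod_group residues_map_def)
next
  fix x y :: "int^'n"
  assume "x \<in> carrier (lattice_group\<lparr>carrier := p_saturation p A\<rparr>)"
    "y \<in> carrier (lattice_group\<lparr>carrier := p_saturation p A\<rparr>)"
  then have "cofactor p i dvd (P *v x) $ i" "cofactor p i dvd (P *v y) $ i" for i
    by (simp_all add: p_saturation_iff[OF p])
  then have "(P *v (x + y)) $ i div cofactor p i = (P *v x) $ i div cofactor p i + (P *v y) $ i div cofactor p i" for i
    by (simp add: matrix_vector_right_distrib div_plus_div_distrib_dvd_left)
  then show "residues_map p q a h (x \<otimes>\<^bsub>lattice_group\<lparr>carrier := p_saturation p A\<rparr>\<^esub> y)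
    = residues_map p q a h x \<otimes>\<^bsub>sum_group {..<a} (\<lambda>_. integer_mod_group q)\<^esub> residues_map p q a h y"
    by (auto simp: lattice_group_def residues_map_def mod_add_eq restrict_def fun_eq_iff)
qed

lemma residues_map_eq_one_iff:
  assumes p: "Factorial_Ring.prime p" and x: "x \<in> p_saturation p A"
    and h: "h ` {..<a} = {i. d i \<noteq> 0 \<and> multiplicity (int p) (d i) = m}"
  shows "residues_map p (p ^ m) a h x = \<one>\<^bsub>sum_group {..<a} (\<lambda>_. integer_mod_group (p ^ m))\<^esub>
    \<longleftrightarrow> (\<forall>i. d i \<noteq> 0 \<and> multiplicity (int p) (d i) = m \<longrightarrow> d i dvd (P *v x) $ i)"
proof -
  have *: "int p ^ m dvd (P *v x) $ i div cofactor p i \<longleftrightarrow> d i dvd (P *v x) $ i"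
    if i: "d i \<noteq> 0" "multiplicity (int p) (d i) = m" for i
  proof -
    have "cofactor p i \<noteq> 0" "d i = int p ^ m * cofactor p i"
      using d_eq_power_cofactor[of i p] i by auto
    moreover have "cofactor p i dvd (P *v x) $ i" using x p_saturation_iff[OF p] by blast
    ultimately show ?thesis by (simp add: dvd_div_iff_mult)
  qed
  have "residues_map p (p ^ m) a h x = \<one>\<^bsub>sum_group {..<a} (\<lambda>_. integer_mod_group (p ^ m))\<^esub>
    \<longleftrightarrow> (\<forall>j<a. int p ^ m dvd (P *v x) $ h j div cofactor p (h j))"
    by (auto simp: residues_map_def restrict_def fun_eq_iff mod_eq_0_iff_dvd)
  also have "\<dots> \<longleftrightarrow> (\<forall>i\<in>h ` {..<a}. int p ^ m dvd (P *v x) $ i div cofactor p i)"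
    by auto
  also have "\<dots> \<longleftrightarrow> (\<forall>i. d i \<noteq> 0 \<and> multiplicity (int p) (d i) = m \<longrightarrow> d i dvd (P *v x) $ i)"
    unfolding h using * by blast
  finally show ?thesis .
qed

text \<open>Multiplying prescribed residues by the cofactors gives coordinates of a preimage; this
  yields surjectivity below.\<close>

lemma residues_map_prescribed:
  assumes h: "bij_betw h {..<a} {i. d i \<noteq> 0 \<and> multiplicity (int p) (d i) = m}"
    and y: "y \<in> carrier (sum_group {..<a} (\<lambda>_. integer_mod_group (p ^ m)))" and p: "p > 0"
    and w: "\<And>i. d i \<noteq> 0 \<Longrightarrow> multiplicity (int p) (d i) = m \<Longrightarrow>
       (P *v x) $ i = cofactor p i * y (the_inv_into {..<a} h i)"
  shows "residues_map p (p ^ m) a h x = y"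
proof
  fix j
  show "residues_map p (p ^ m) a h x j = y j"
  proof (cases "j < a")
    case True
    have hj: "d (h j) \<noteq> 0" "multiplicity (int p) (d (h j)) = m"
      using h True by (auto simp: bij_betw_def)
    have "cofactor p (h j) \<noteq> 0" using d_eq_power_cofactor[of "h j" p] hj(1) by auto
    moreover have "the_inv_into {..<a} h (h j) = j"
      using h True by (simp add: bij_betw_def the_inv_into_f_f)
    moreover have "y j mod int p ^ m = y j"
      using y True p by (auto simp: carrier_sum_group carrier_integer_mod_group PiE_iff)
    ultimately show ?thesis using True w[OF hj] by (simp add: residues_map_def)
  next
    case False
    then show ?thesis using y by (auto simp: residues_map_def carrier_sum_group PiE_def extensional_def)
  qed
qed

text \<open>The residue maps for valuations 1, 2 and 3 together form a surjection from the saturated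
  lattice with kernel the image of \<open>A\<close>; the first isomorphism theorem then gives the
  type.\<close>

lemma sylow_torsion_cokernel_iso:
  assumes p: "Factorial_Ring.prime p"
    and le3: "\<And>i. d i \<noteq> 0 \<Longrightarrow> multiplicity (int p) (d i) \<le> 3"
  defines "I \<equiv> \<lambda>m. {i. d i \<noteq> 0 \<and> multiplicity (int p) (d i) = m}"
  shows "sylow_part p (torsion_part (cokernel A))
    \<cong> abelian_type3 p (card (I 1)) (card (I 2)) (card (I 3))"
proof -
  have p0: "p > 0" using p by (simp add: prime_gt_0_nat)
  have "\<exists>h. bij_betw h {..<card (I m)} (I m)" for m
    using ex_bij_betw_nat_finite[of "I m"] by (simp add: atLeast0LessThan)
  then obtain h where h: "\<And>m. bij_betw (h m) {..<card (I m)} (I m)" by metis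
  define G where "G = lattice_group\<lparr>carrier := p_saturation p A\<rparr>"
  define \<phi> where "\<phi> = (\<lambda>m. residues_map p (p ^ m) (card (I m)) (h m))"
  define S where "S = (\<lambda>m. sum_group {..<card (I m)} (\<lambda>_. integer_mod_group (p ^ m)))"
  define T where "T = abelian_type3 p (card (I 1)) (card (I 2)) (card (I 3))"
  define \<psi> where "\<psi> = (\<lambda>x. (\<phi> 1 x, \<phi> 2 x, \<phi> 3 x))"
  have T: "T = S 1 \<times>\<times> S 2 \<times>\<times> S 3"
    by (simp add: T_def abelian_type3_def S_def)
  have grS: "group (S m)" for m by (simp add: S_def)
  have grT: "group T" unfolding T by (intro DirProd_group grS)
  have carG: "carrier G = p_saturation p A" by (simp add: G_def)
  have phi_hom: "\<phi> m \<in> hom G (S m)" for m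
    unfolding \<phi>_def G_def S_def using p p0 by (intro residues_map_hom) auto
  have psi_hom: "\<psi> \<in> hom G T"
    unfolding T \<psi>_def hom_paired using phi_hom by blast
  interpret L: comm_group "lattice_group :: (int^'n) monoid" by (rule comm_group_lattice_group)
  have zero: "0 \<in> p_saturation p A" by (simp add: p_saturation_iff[OF p])
  have "subgroup (p_saturation p A) lattice_group"
  proof (rule L.subgroupI)
    fix x assume x: "x \<in> p_saturation p A"
    have "inv\<^bsub>lattice_group\<^esub> x = - x"
      by (rule L.inv_equality) (simp_all add: lattice_group_def)
    moreover have "P *v (- x) = - (P *v x)" by (simp add: matrix_vector_mult_def vec_eq_iff sum_negf)
    ultimately show "inv\<^bsub>lattice_group\<^esub> x \<in> p_saturation p A"
      using x by (simp add: p_saturation_iff[OF p])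
  next
    fix x y assume "x \<in> p_saturation p A" "y \<in> p_saturation p A"
    then show "x \<otimes>\<^bsub>lattice_group\<^esub> y \<in> p_saturation p A"
      by (simp add: p_saturation_iff[OF p] lattice_group_def matrix_vector_right_distrib)
  qed (use zero in \<open>auto simp: carrier_lattice_group\<close>)
  then have grG: "group G" unfolding G_def by (rule L.subgroup_imp_group)
  interpret gh: group_hom G T \<psi>
    using grG grT psi_hom by (simp add: group_hom_def group_hom_axioms_def)
  have ker: "kernel G T \<psi> = range (\<lambda>x. A *v x)"
  proof -
    have "\<psi> x = \<one>\<^bsub>T\<^esub> \<longleftrightarrow> (\<forall>i. d i dvd (P *v x) $ i)" if x: "x \<in> p_saturation p A" for x
    proof -
      have c: "cofactor p i dvd (P *v x) $ i" for i using x p_saturation_iff[OF p] by blast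
      have "\<phi> m x = \<one>\<^bsub>S m\<^esub> \<longleftrightarrow> (\<forall>i. d i \<noteq> 0 \<and> multiplicity (int p) (d i) = m \<longrightarrow> d i dvd (P *v x) $ i)" for m
        unfolding \<phi>_def S_def using h[of m]
        by (intro residues_map_eq_one_iff[OF p x]) (simp add: bij_betw_def I_def)
      then have "\<psi> x = \<one>\<^bsub>T\<^esub> \<longleftrightarrow> (\<forall>m\<in>{1,2,3}. \<forall>i. d i \<noteq> 0 \<and> multiplicity (int p) (d i) = m \<longrightarrow> d i dvd (P *v x) $ i)"
        by (simp add: \<psi>_def T)
      also have "\<dots> \<longleftrightarrow> (\<forall>i. d i dvd (P *v x) $ i)"
      proof (intro iffI allI)
        fix i
        assume *: "\<forall>m\<in>{1, 2, 3}. \<forall>i. d i \<noteq> 0 \<and> multiplicity (int p) (d i) = m \<longrightarrow> d i dvd (P *v x) $ i"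
        \<comment> \<open>In the first case no residue is taken, but \<open>d i\<close> equals its
          cofactor, so membership in the saturation already gives the divisibility.\<close>
        consider "d i = 0 \<or> multiplicity (int p) (d i) = 0" | "d i \<noteq> 0" "multiplicity (int p) (d i) \<in> {1,2,3}"
          using le3[of i] by fastforce
        then show "d i dvd (P *v x) $ i"
        proof cases
          case 1
          then have "cofactor p i = d i" by (auto simp: cofactor_def)
          then show ?thesis using c[of i] by simp
        next
          case 2
          then show ?thesis using * by blast
        qed
      qed blast
      finally show ?thesis .
    qed
    moreover have "range (\<lambda>x. A *v x) \<subseteq> p_saturation p A"
      by (force simp: p_saturation_def intro: exI[of _ 0])
    ultimately show ?thesis
      unfolding kernel_def carG using range_A_iff by blast
  qed
  have "\<psi> ` carrier G = carrier T"
  proof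
    show "\<psi> ` carrier G \<subseteq> carrier T" using psi_hom by (auto simp: hom_def)
    show "carrier T \<subseteq> \<psi> ` carrier G"
    proof
      fix y assume "y \<in> carrier T"
      then obtain y1 y2 y3 where y: "y = (y1, y2, y3)" "y1 \<in> carrier (S 1)" "y2 \<in> carrier (S 2)" "y3 \<in> carrier (S 3)"
        by (auto simp: T)
      \<comment> \<open>At valuation 0 the default \<open>y3\<close> is harmless: the coordinate is
        still a multiple of the cofactor, and no residue is read there.\<close>
      define yy where "yy = (\<lambda>m::nat. if m = 1 then y1 else if m = 2 then y2 else y3)"
      have yy: "yy m \<in> carrier (S m)" if "m \<in> {1,2,3}" for m
        using that y by (auto simp: yy_def)
      define x where "x = P' *v (\<chi> i. cofactor p i *
         yy (multiplicity (int p) (d i)) (the_inv_into {..<card (I (multiplicity (int p) (d i)))}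
           (h (multiplicity (int p) (d i))) i))"
      have xP: "(P *v x) $ i = cofactor p i *
         yy (multiplicity (int p) (d i)) (the_inv_into {..<card (I (multiplicity (int p) (d i)))}
           (h (multiplicity (int p) (d i))) i)" for i
        by (simp add: x_def P_P'_vec)
      have xG: "x \<in> carrier G"
        unfolding carG p_saturation_iff[OF p] xP by simp
      have "\<phi> m x = yy m" if "m \<in> {1,2,3}" for m
        unfolding \<phi>_def using h[of m] yy[OF that] p0 xP unfolding S_def
        by (intro residues_map_prescribed) (auto simp: I_def)
      then have "\<psi> x = y" by (simp add: \<psi>_def y(1) yy_def)
      then show "y \<in> \<psi> ` carrier G" using xG by blast
    qed
  qed
  then have "G Mod range (\<lambda>x. A *v x) \<cong> T" unfolding ker[symmetric] by (rule gh.FactGroup_iso)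
  then show ?thesis
    unfolding sylow_torsion_cokernel[OF p0] ker by (simp add: G_def T_def)
qed

end

section \<open>Laplacians with two nonzero eigenvalues\<close>

lemma det_eq_prod_eigenbasis:
  fixes M :: "real^'n::finite^'n"
  assumes B: "card B = CARD('n)" "span B = UNIV" and eig: "\<And>b. b \<in> B \<Longrightarrow> M *v b = c b *\<^sub>R b"
  shows "det M = (\<Prod>b\<in>B. c b)"
proof -
  have "finite B" using B(1) by (intro card_ge_0_finite) simp
  then obtain \<beta> where \<beta>: "bij_betw \<beta> (UNIV :: 'n set) B"
    using finite_same_card_bij[of "UNIV :: 'n set" B] B(1) by auto
  define W :: "real^'n^'n" where "W = (\<chi> i j. \<beta> j $ i)"
  define D :: "real^'n^'n" where "D = (\<chi> i j. if i = j then c (\<beta> i) else 0)"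
  have "columns W = B"
    using \<beta> by (auto simp: columns_def column_def W_def bij_betw_def)
  then have "vec.span (columns W) = UNIV" using B(2) by (simp add: span_vec_eq)
  then have "invertible W"
    unfolding invertible_right_inverse matrix_right_invertible_span_columns .
  then have W: "det W \<noteq> 0" by (simp add: invertible_det_nz)
  have "M ** W = W ** D"
  proof -
    have "(M ** W) $ i $ j = (W ** D) $ i $ j" for i j
    proof -
      have "(M ** W) $ i $ j = (M *v \<beta> j) $ i"
        by (simp add: matrix_matrix_mult_def matrix_vector_mult_def W_def)
      also have "\<dots> = c (\<beta> j) * \<beta> j $ i"
        using eig[of "\<beta> j"] \<beta> by (auto simp: bij_betw_def)
      also have "\<dots> = (W ** D) $ i $ j"
        by (simp add: matrix_matrix_mult_def W_def D_def if_distrib[of "\<lambda>y. _ * y"] mult.commute cong: if_cong)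
      finally show ?thesis .
    qed
    then show ?thesis by (simp add: vec_eq_iff)
  qed
  then have "det (M ** W) = det (W ** D)" by simp
  then have "det M = det D" using W by (simp add: det_mul)
  also have "det D = (\<Prod>i\<in>UNIV. c (\<beta> i))"
    by (subst det_diagonal) (simp_all add: D_def)
  also have "\<dots> = (\<Prod>b\<in>B. c b)"
    using \<beta> by (rule prod.reindex_bij_betw)
  finally show ?thesis .
qed

text \<open>Since \<open>d z = 0\<close>, the matrix factors as \<open>M1 ** M2 ** M3\<close>: the
  identity with column \<open>z\<close> replaced by \<open>u\<close>, a diagonal matrix with 1 at
  \<open>z\<close>, and the identity with row \<open>z\<close> replaced by \<open>w\<close>.
  Cramer's rule for the identity gives the outer determinants.\<close>

lemma det_diagonal_plus_rank_one:
  fixes u w :: "real^'n::finite"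
  assumes "d z = 0"
  shows "det (\<chi> i j. (if i = j then d i else 0) + u $ i * w $ j) = u $ z * w $ z * (\<Prod>i\<in>UNIV - {z}. d i)"
proof -
  define M1 :: "real^'n^'n" where "M1 = (\<chi> i j. if j = z then u $ i else if i = j then 1 else 0)"
  define M2 :: "real^'n^'n" where "M2 = (\<chi> i j. if i = j then (if i = z then 1 else d i) else 0)"
  define M3 :: "real^'n^'n" where "M3 = (\<chi> i j. if i = z then w $ j else if i = j then 1 else 0)"
  have cr: "det (\<chi> i j. if j = z then x $ i else if i = j then 1 else 0) = x $ z" for x :: "real^'n"
  proof -
    have "(\<chi> i j. if j = z then x $ i else if i = j then 1 else 0)
        = (\<chi> i j. if j = z then (mat 1 *v x) $ i else (mat 1 :: real^'n^'n) $ i $ j)"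
      unfolding matrix_vector_mul_lid by (simp add: mat_def vec_eq_iff)
    then show ?thesis using cramer_lemma[of z "mat 1" x] by simp
  qed
  have d1: "det M1 = u $ z" unfolding M1_def by (rule cr)
  have "transpose M3 = (\<chi> i j. if j = z then w $ i else if i = j then 1 else 0)"
    by (auto simp: M3_def transpose_def vec_eq_iff)
  then have d3: "det M3 = w $ z" using cr[of w] det_transpose[of M3] by simp
  have "det M2 = (\<Prod>i\<in>UNIV. if i = z then 1 else d i)"
    by (subst det_diagonal) (simp_all add: M2_def)
  also have "\<dots> = (\<Prod>i\<in>UNIV - {z}. d i)"
    by (simp add: prod.remove[of UNIV z])
  finally have d2: "det M2 = (\<Prod>i\<in>UNIV - {z}. d i)" .
  have e23: "(M2 ** M3) $ l $ j = (if l = z then w $ j else if l = j then d l else 0)" for l j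
    by (simp add: matrix_matrix_mult_def M2_def M3_def if_distrib[of "\<lambda>y. y * _"] cong: if_cong)
  have "(M1 ** (M2 ** M3)) $ i $ j = (if i = j then d i else 0) + u $ i * w $ j" for i j
  proof -
    have "(M1 ** (M2 ** M3)) $ i $ j = (\<Sum>l\<in>UNIV. M1 $ i $ l * (M2 ** M3) $ l $ j)"
      by (simp add: matrix_matrix_mult_def)
    also have "\<dots> = (\<Sum>l\<in>UNIV. (if l = z then u $ i * w $ j else 0) + (if l = i then (if i = j then d i else 0) else 0))"
      unfolding e23 by (rule sum.cong) (auto simp: M1_def assms)
    also have "\<dots> = (if i = j then d i else 0) + u $ i * w $ j"
      by (simp add: sum.distrib)
    finally show ?thesis .
  qed
  then have "(\<chi> i j. (if i = j then d i else 0) + u $ i * w $ j) = M1 ** (M2 ** M3)"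
    by (simp add: vec_eq_iff)
  then show ?thesis by (simp add: det_mul d1 d2 d3)
qed

lemma det_real_mat: "det (real_mat A) = real_of_int (det (A :: int^'n::finite^'n))"
  by (simp add: det_def real_mat_def)

text \<open>\<open>quad\<close> is the entrywise form of \<open>(L - r)(L - s) = \<mu> J\<close>.
  The conditions are symmetric in \<open>r\<close> and \<open>s\<close>, so every result holds with
  the two exchanged.\<close>

locale two_eigenvalue_laplacian =
  fixes L :: "int^'n::finite^'n" and r s \<mu> :: int
  assumes sym: "L $ i $ j = L $ j $ i"
    and row_sum: "(\<Sum>j\<in>UNIV. L $ i $ j) = 0"
    and quad: "(L ** L) $ i $ j = (r + s) * L $ i $ j - (if i = j then r * s else 0) + \<mu>"
    and nonzero: "r \<noteq> 0" "s \<noteq> 0" and distinct: "r \<noteq> s"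
begin

abbreviation "RL \<equiv> real_mat L"

lemma transpose_RL: "transpose RL = RL"
  by (simp add: transpose_def real_mat_def vec_eq_iff, intro allI, rule sym)

lemma RL_symmetric: "x v* RL = RL *v x"
  by (metis transpose_RL transpose_matrix_vector)

lemma RL_quad: "RL *v (RL *v x) = of_int (r + s) *\<^sub>R (RL *v x) - of_int (r * s) *\<^sub>R x
    + of_int \<mu> *\<^sub>R (\<chi> i. \<Sum>j\<in>UNIV. x $ j)"
proof -
  have "RL *v (RL *v x) = real_mat (L ** L) *v x"
    by (simp add: real_mat_mult matrix_vector_mul_assoc)
  also have "real_mat (L ** L) = (\<chi> i j. of_int (r + s) * RL $ i $ j - (if i = j then of_int (r * s) else 0) + of_int \<mu>)"
    unfolding real_mat_def quad by (simp add: vec_eq_iff)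
  also have "\<dots> *v x = of_int (r + s) *\<^sub>R (RL *v x) - of_int (r * s) *\<^sub>R x
    + of_int \<mu> *\<^sub>R (\<chi> i. \<Sum>j\<in>UNIV. x $ j)"
    by (simp add: vec_eq_iff matrix_vector_mult_def distrib_right left_diff_distrib sum.distrib sum_subtractf
        sum_distrib_left mult.assoc if_distrib[of "\<lambda>y. y * _"] cong: if_cong)
  finally show ?thesis .
qed

section \<open>Eigenspaces of the real Laplacian\<close>

abbreviation "eigenspace c \<equiv> {x. RL *v x = c *\<^sub>R x}"

lemma subspace_eigenspace: "subspace (eigenspace c)"
  by (auto intro!: subspaceI simp: matrix_vector_right_distrib matrix_vector_mult_scaleR scaleR_right_distrib)

lemma eigenspaces_orthogonal:
  assumes "x \<in> eigenspace a" "y \<in> eigenspace b" "a \<noteq> b"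
  shows "x \<bullet> y = 0"
proof -
  have "a * (x \<bullet> y) = (RL *v x) \<bullet> y" using assms(1) by simp
  also have "\<dots> = x \<bullet> (RL *v y)" by (metis RL_symmetric dot_lmul_matrix)
  also have "\<dots> = b * (x \<bullet> y)" using assms(2) by simp
  finally show ?thesis using assms(3) by simp
qed

lemma one_eigenspace: "1 \<in> eigenspace 0"
  using row_sum by (simp add: matrix_vector_mult_def real_mat_def vec_eq_iff flip: of_int_sum)

lemma one_inner: "1 \<bullet> (x :: real^'n) = (\<Sum>j\<in>UNIV. x $ j)"
  by (simp add: inner_vec_def)

lemma sum_eigenspace:
  assumes "x \<in> eigenspace c" "c \<noteq> 0"
  shows "(\<Sum>j\<in>UNIV. x $ j) = 0"
  using eigenspaces_orthogonal[OF one_eigenspace assms(1)] assms(2) by (simp add: one_inner)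

text \<open>The term with \<open>\<mu>\<close> vanishes on \<open>x\<close>, so
  \<open>(L - r)(L - s) x = 0\<close>. Thus \<open>(L - s) x\<close> and \<open>(L - r) x\<close>
  are eigenvectors or zero, and their difference is \<open>(r - s) x\<close>.\<close>

lemma sum_zero_decomposition:
  assumes "(\<Sum>j\<in>UNIV. x $ j) = 0"
  obtains y z where "y \<in> eigenspace r" "z \<in> eigenspace s" "x = y + z"
proof
  let ?k = "inverse (real_of_int r - real_of_int s)"
  define y where "y = RL *v x - of_int s *\<^sub>R x"
  define z where "z = RL *v x - of_int r *\<^sub>R x"
  have q: "RL *v (RL *v x) = of_int (r + s) *\<^sub>R (RL *v x) - of_int (r * s) *\<^sub>R x"
    using RL_quad[of x] assms by (simp add: vec_eq_iff)
  have "y \<in> eigenspace r"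
    by (simp add: y_def matrix_vector_mult_diff_distrib matrix_vector_mult_scaleR q vec_eq_iff algebra_simps)
  then show "?k *\<^sub>R y \<in> eigenspace r" by (rule subspace_scale[OF subspace_eigenspace])
  have "z \<in> eigenspace s"
    by (simp add: z_def matrix_vector_mult_diff_distrib matrix_vector_mult_scaleR q vec_eq_iff algebra_simps)
  then show "(- ?k) *\<^sub>R z \<in> eigenspace s" by (rule subspace_scale[OF subspace_eigenspace])
  have "?k *\<^sub>R y + (- ?k) *\<^sub>R z = ?k *\<^sub>R ((real_of_int r - real_of_int s) *\<^sub>R x)"
    by (simp add: y_def z_def vec_eq_iff algebra_simps)
  also have "\<dots> = x" using distinct by simp
  finally show "x = ?k *\<^sub>R y + (- ?k) *\<^sub>R z" ..
qed

lemma exists_eigenbasis: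
  obtains B C where "B \<subseteq> eigenspace r" "C \<subseteq> eigenspace s" "finite B" "finite C"
    "card B = dim (eigenspace r)" "card C = dim (eigenspace s)" "1 \<notin> B" "1 \<notin> C" "B \<inter> C = {}"
    "span (insert 1 (B \<union> C)) = UNIV" "independent (insert 1 (B \<union> C))"
proof -
  obtain B where B: "B \<subseteq> eigenspace r" "pairwise orthogonal B" "\<And>x. x \<in> B \<Longrightarrow> norm x = 1"
    "independent B" "card B = dim (eigenspace r)" "span B = eigenspace r"
    using that by (rule orthonormal_basis_subspace[OF subspace_eigenspace[of "of_int r"]])
  obtain C where C: "C \<subseteq> eigenspace s" "pairwise orthogonal C" "\<And>x. x \<in> C \<Longrightarrow> norm x = 1"
    "independent C" "card C = dim (eigenspace s)" "span C = eigenspace s"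
    using that by (rule orthonormal_basis_subspace[OF subspace_eigenspace[of "of_int s"]])
  have BC: "b \<bullet> c = 0" if "b \<in> B" "c \<in> C" for b c
    using eigenspaces_orthogonal[of b r c s] that B(1) C(1) distinct by auto
  then have CB: "c \<bullet> b = 0" if "b \<in> B" "c \<in> C" for b c
    using that by (simp add: inner_commute)
  have B1: "1 \<bullet> b = 0" if "b \<in> B" for b
    using eigenspaces_orthogonal[OF one_eigenspace, of b r] that B(1) nonzero by auto
  have C1: "1 \<bullet> c = 0" if "c \<in> C" for c
    using eigenspaces_orthogonal[OF one_eigenspace, of c s] that C(1) nonzero by auto
  have one: "(1 :: real^'n) \<noteq> 0" by (simp add: vec_eq_iff)
  then have n1: "1 \<notin> B" "1 \<notin> C" using B1 C1 by force+
  have disj: "B \<inter> C = {}" using BC B(3) by force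
  have po: "pairwise orthogonal (insert 1 (B \<union> C))"
    using B(2) C(2) BC CB B1 C1 unfolding pairwise_insert
    by (auto simp: pairwise_def orthogonal_def inner_commute[of _ 1])
  moreover have "0 \<notin> insert 1 (B \<union> C)" using one B(3) C(3) by force
  ultimately have ind: "independent (insert 1 (B \<union> C))" by (rule pairwise_orthogonal_independent)
  have "x \<in> span (insert 1 (B \<union> C))" for x
  proof -
    \<comment> \<open>Subtracting the mean leaves a vector of coordinate sum 0, which the two
      eigenspaces span.\<close>
    define a where "a = (\<Sum>j\<in>UNIV. x $ j) / real CARD('n)"
    have "(\<Sum>j\<in>UNIV. (x - a *\<^sub>R 1) $ j) = 0"
      by (simp add: sum_subtractf a_def)
    then obtain y z where yz: "y \<in> eigenspace r" "z \<in> eigenspace s" "x - a *\<^sub>R 1 = y + z"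
      by (rule sum_zero_decomposition)
    have "y \<in> span (insert 1 (B \<union> C))" "z \<in> span (insert 1 (B \<union> C))"
      using yz(1,2) B(6) C(6) span_mono[of B "insert 1 (B \<union> C)"] span_mono[of C "insert 1 (B \<union> C)"]
      by blast+
    moreover have "a *\<^sub>R 1 \<in> span (insert 1 (B \<union> C))" by (simp add: span_base span_scale)
    moreover have "x = a *\<^sub>R 1 + (y + z)" using yz(3) by (simp add: algebra_simps)
    ultimately show ?thesis by (metis span_add)
  qed
  then show ?thesis
    using that[OF B(1) C(1) independent_imp_finite[OF B(4)] independent_imp_finite[OF C(4)]
        B(5) C(5) n1 disj _ ind] by blast
qed

text \<open>The all-ones matrix annihilates the eigenvectors for \<open>r\<close> and
  \<open>s\<close>, which have coordinate sum 0, and multiplies the all-ones vector by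
  \<open>CARD('n)\<close>. So \<open>L + J\<close> has eigenvalues \<open>CARD('n)\<close>,
  \<open>r\<close> and \<open>s\<close> on the eigenbasis.\<close>

lemma
  shows dim_eigenspaces: "1 + dim (eigenspace r) + dim (eigenspace s) = CARD('n)"
    and det_RL_plus_J: "det (\<chi> i j. RL $ i $ j + 1)
      = real CARD('n) * of_int r ^ dim (eigenspace r) * of_int s ^ dim (eigenspace s)"
proof -
  obtain B C where B: "B \<subseteq> eigenspace r" and C: "C \<subseteq> eigenspace s" and fin: "finite B" "finite C"
    and card: "card B = dim (eigenspace r)" "card C = dim (eigenspace s)"
    and dis: "1 \<notin> B" "1 \<notin> C" "B \<inter> C = {}"
    and span: "span (insert 1 (B \<union> C)) = UNIV" and ind: "independent (insert 1 (B \<union> C))"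
    by (rule exists_eigenbasis)
  have "card (insert 1 (B \<union> C)) = 1 + dim (eigenspace r) + dim (eigenspace s)"
    using fin dis by (simp add: card_Un_disjoint card)
  moreover have c: "card (insert 1 (B \<union> C)) = CARD('n)"
    using dim_span_eq_card_independent[OF ind] span by simp
  ultimately show "1 + dim (eigenspace r) + dim (eigenspace s) = CARD('n)" by simp
  define M :: "real^'n^'n" where "M = (\<chi> i j. RL $ i $ j + 1)"
  define e where "e = (\<lambda>b::real^'n. if b = 1 then real CARD('n) else if b \<in> B then of_int r else of_int s)"
  have M: "M *v x = RL *v x + (\<chi> i. \<Sum>j\<in>UNIV. x $ j)" for x
    by (simp add: M_def matrix_vector_mult_def vec_eq_iff distrib_right sum.distrib)
  have "det M = (\<Prod>b\<in>insert 1 (B \<union> C). e b)"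
  proof (rule det_eq_prod_eigenbasis[OF c span])
    fix b assume "b \<in> insert 1 (B \<union> C)"
    then consider "b = 1" | "b \<noteq> 1" "b \<in> B" | "b \<noteq> 1" "b \<in> C" "b \<notin> B" using dis by blast
    then show "M *v b = e b *\<^sub>R b"
    proof cases
      case 1
      have "M *v 1 = real CARD('n) *\<^sub>R 1" using one_eigenspace by (simp add: M) (simp add: vec_eq_iff)
      then show ?thesis using 1 by (simp add: e_def)
    next
      case 2
      then have "b \<in> eigenspace r" using B by blast
      then have "M *v b = of_int r *\<^sub>R b"
        using sum_eigenspace[of b "of_int r"] nonzero by (simp add: M) (simp add: vec_eq_iff)
      then show ?thesis using 2 by (simp add: e_def)
    next
      case 3
      then have "b \<in> eigenspace s" using C by blast
      then have "M *v b = of_int s *\<^sub>R b"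
        using sum_eigenspace[of b "of_int s"] nonzero by (simp add: M) (simp add: vec_eq_iff)
      then show ?thesis using 3 by (simp add: e_def)
    qed
  qed
  also have "\<dots> = e 1 * ((\<Prod>b\<in>B. e b) * (\<Prod>b\<in>C. e b))"
    using fin dis by (simp add: prod.union_disjoint)
  also have "(\<Prod>b\<in>B. e b) = (\<Prod>b\<in>B. of_int r)"
    by (rule prod.cong) (use dis in \<open>auto simp: e_def\<close>)
  also have "(\<Prod>b\<in>C. e b) = (\<Prod>b\<in>C. of_int s)"
    by (rule prod.cong) (use dis in \<open>auto simp: e_def\<close>)
  finally show "det (\<chi> i j. RL $ i $ j + 1)
      = real CARD('n) * of_int r ^ dim (eigenspace r) * of_int s ^ dim (eigenspace s)"
    by (simp add: M_def e_def card)
qed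

lemma int_quad_vec:
  "(L *v (L *v x)) $ i = (r + s) * (L *v x) $ i - r * s * x $ i + \<mu> * (\<Sum>j\<in>UNIV. x $ j)"
proof -
  have "(L *v (L *v x)) $ i = (\<Sum>j\<in>UNIV. (L ** L) $ i $ j * x $ j)"
    unfolding matrix_vector_mul_assoc by (simp add: matrix_vector_mult_def)
  also have "\<dots> = (r + s) * (\<Sum>j\<in>UNIV. L $ i $ j * x $ j) - r * s * x $ i + \<mu> * (\<Sum>j\<in>UNIV. x $ j)"
    unfolding quad by (simp add: distrib_right left_diff_distrib sum.distrib sum_subtractf
        sum_distrib_left mult.assoc if_distrib[of "\<lambda>y. y * _"] cong: if_cong)
  finally show ?thesis by (simp add: matrix_vector_mult_def)
qed

text \<open>For \<open>L *v x = 0\<close> the quadratic identity leaves \<open>r * s * x $ i\<close>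
  equal to an expression independent of \<open>i\<close>.\<close>

lemma int_kernel_constant:
  assumes "L *v x = 0"
  shows "x $ i = x $ j"
proof -
  have "r * s * x $ i = \<mu> * (\<Sum>j\<in>UNIV. x $ j)" for i
    using int_quad_vec[of x i] assms by simp
  then have "r * s * x $ i = r * s * x $ j" by simp
  then show ?thesis using nonzero by simp
qed

end

section \<open>Elementary divisors of the Laplacian\<close>

lemma abs_det_unimodular:
  fixes P P' :: "int^'n::finite^'n"
  assumes "P ** P' = mat 1"
  shows "\<bar>det P\<bar> = 1"
proof -
  have "det P * det P' = 1" using assms by (metis det_I det_mul)
  then have "is_unit (det P)" by (metis dvd_triv_left)
  then show ?thesis by simp
qed

lemma int_matrix_mult_smult: "(A :: int^'n::finite^'m) *v (c *s x) = c *s (A *v x)"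
  by (simp add: matrix_vector_mult_def vec_eq_iff sum_distrib_left mult.left_commute)

locale diagonalized_laplacian =
  two_eigenvalue_laplacian L r s \<mu> + int_diagonalization L P P' Q Q' d
  for L :: "int^'n::finite^'n" and r s \<mu> P P' Q Q' d
begin

text \<open>Column \<open>i\<close> of \<open>Q\<close> lies in the kernel of \<open>L\<close>,
  hence is constant; its common value divides coordinate \<open>i\<close> of \<open>Q' *v x\<close>,
  which is 1.\<close>

lemma zero_diag_column_Q:
  assumes "d i = 0"
  shows "\<exists>q. \<bar>q\<bar> = 1 \<and> (\<forall>j. Q $ j $ i = q)"
proof -
  define x where "x = Q *v axis i 1"
  have x: "x $ j = Q $ j $ i" for j
    by (simp add: x_def matrix_vector_mult_def axis_def if_distrib[of "\<lambda>y. _ * y"] cong: if_cong)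
  have Q'x: "Q' *v x = axis i 1" by (simp add: x_def matrix_vector_mul_assoc Q'Q)
  have "P *v (L *v x) = 0"
    using assms by (simp add: vec_eq_iff P_mult_A_vec Q'x axis_def)
  then have "L *v x = 0" using P'_P_vec[of "L *v x"] by simp
  then have c: "x $ j = x $ i" for j by (rule int_kernel_constant)
  have "x $ i dvd (Q' *v x) $ i" by (rule dvd_matrix_vector_mult) (metis c dvd_refl)
  then have "\<bar>x $ i\<bar> = 1" by (simp add: Q'x axis_def)
  moreover have "\<forall>j. Q $ j $ i = x $ i" using c x by simp
  ultimately show ?thesis by blast
qed

lemma zero_diag_row_P:
  assumes "d i = 0"
  shows "\<exists>q. \<bar>q\<bar> = 1 \<and> (\<forall>j. P $ i $ j = q)"
proof -
  have "L *v (P $ i) = 0"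
  proof -
    have "(L *v (P $ i)) $ j = (P ** L) $ i $ j" for j
    proof -
      have "L $ j $ k * P $ i $ k = P $ i $ k * L $ k $ j" for k
        using sym[of j k] by (simp only: mult.commute)
      then have "(\<Sum>k\<in>UNIV. L $ j $ k * P $ i $ k) = (\<Sum>k\<in>UNIV. P $ i $ k * L $ k $ j)"
        by (intro sum.cong refl)
      then show ?thesis by (simp add: matrix_vector_mult_def matrix_matrix_mult_def)
    qed
    moreover have "(P ** L) $ i $ j = 0" for j
      unfolding P_mult_A using assms
      by (simp add: matrix_matrix_mult_def if_distrib[of "\<lambda>y. y * _"] cong: if_cong)
    ultimately show ?thesis by (simp add: vec_eq_iff)
  qed
  then have c: "P $ i $ j = P $ i $ i" for j by (rule int_kernel_constant)
  have "P $ i $ i dvd (\<Sum>k\<in>UNIV. P $ i $ k * P' $ k $ i)"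
    by (intro dvd_sum dvd_mult2) (metis c dvd_refl)
  also have "\<dots> = (P ** P') $ i $ i" by (simp add: matrix_matrix_mult_def)
  finally have "\<bar>P $ i $ i\<bar> = 1" by (simp add: PP' mat_def)
  then show ?thesis using c by blast
qed

text \<open>Some entry vanishes because \<open>L\<close> kills the all-ones vector. Two zero entries
  would give two columns of \<open>Q\<close> equal up to sign, incompatible with
  \<open>Q' ** Q = mat 1\<close>.\<close>

lemma unique_zero_diag: "\<exists>!z. d z = 0"
proof (rule ex_ex1I)
  show "\<exists>z. d z = 0"
  proof (rule ccontr)
    assume nz: "\<nexists>z. d z = 0"
    have "L *v 1 = 0" by (simp add: matrix_vector_mult_def vec_eq_iff row_sum)
    then have "d i * (Q' *v 1) $ i = 0" for i
      using P_mult_A_vec[of 1 i] by simp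
    then have "Q' *v 1 = 0" using nz by (simp add: vec_eq_iff)
    then have "(1 :: int^'n) = 0" using Q_Q'_vec[of 1] by simp
    then show False by (simp add: vec_eq_iff)
  qed
next
  fix i j assume "d i = 0" "d j = 0"
  obtain q where q: "\<bar>q\<bar> = 1" "\<forall>k. Q $ k $ i = q" using zero_diag_column_Q[OF \<open>d i = 0\<close>] by (elim exE conjE) (rule that)
  obtain q' where q': "\<bar>q'\<bar> = 1" "\<forall>k. Q $ k $ j = q'" using zero_diag_column_Q[OF \<open>d j = 0\<close>] by (elim exE conjE) (rule that)
  have "(\<Sum>k\<in>UNIV. Q' $ i $ k * Q $ k $ l) = (if i = l then 1 else 0)" for l
    using Q'Q by (simp add: matrix_matrix_mult_def mat_def vec_eq_iff)
  from this[of i] this[of j] have "(\<Sum>k\<in>UNIV. Q' $ i $ k) * q = 1"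
    "(\<Sum>k\<in>UNIV. Q' $ i $ k) * q' = (if i = j then 1 else 0)"
    by (simp_all add: q q' sum_distrib_right)
  then show "i = j" using q'(1) by (auto split: if_splits)
qed

definition zero_index :: 'n where "zero_index = (THE z. d z = 0)"

lemma d_eq_0_iff: "d i = 0 \<longleftrightarrow> i = zero_index"
proof -
  have "d zero_index = 0" unfolding zero_index_def by (rule theI'[OF unique_zero_diag])
  then show ?thesis using unique_zero_diag by blast
qed

abbreviation "f \<equiv> dim (eigenspace (of_int r))"
abbreviation "g \<equiv> dim (eigenspace (of_int s))"

text \<open>\<open>P ** (L + J) ** Q\<close> is the diagonal matrix plus the product of the row sums
  \<open>u\<close> of \<open>P\<close> and the column sums \<open>w\<close> of \<open>Q\<close>. At
  \<open>zero_index\<close> both are \<open>CARD('n)\<close> up to sign. Comparing with the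
  determinant from the eigenbasis and cancelling one factor \<open>CARD('n)\<close> gives a form of
  Kirchhoff's theorem.\<close>

lemma card_mult_prod_diag:
  "int CARD('n) * \<bar>\<Prod>i\<in>UNIV - {zero_index}. d i\<bar> = \<bar>r\<bar> ^ f * \<bar>s\<bar> ^ g"
proof -
  let ?z = zero_index and ?n = "int CARD('n)"
  define LJ :: "int^'n^'n" where "LJ = (\<chi> i j. L $ i $ j + 1)"
  define u where "u = (\<lambda>i. \<Sum>k\<in>UNIV. P $ i $ k)"
  define w where "w = (\<lambda>j. \<Sum>k\<in>UNIV. Q $ k $ j)"
  have dz: "d ?z = 0" by (simp add: d_eq_0_iff)
  obtain q where q: "\<bar>q\<bar> = 1" "\<forall>j. P $ ?z $ j = q" using zero_diag_row_P[OF dz] by (elim exE conjE) (rule that)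
  obtain q' where q': "\<bar>q'\<bar> = 1" "\<forall>j. Q $ j $ ?z = q'" using zero_diag_column_Q[OF dz] by (elim exE conjE) (rule that)
  have u: "\<bar>u ?z\<bar> = ?n" and w: "\<bar>w ?z\<bar> = ?n"
    by (simp_all add: u_def w_def q q' abs_mult)
  have 1: "(P ** LJ) $ i $ k = (P ** L) $ i $ k + u i" for i k
    by (simp add: LJ_def u_def matrix_matrix_mult_def distrib_left sum.distrib)
  have "(P ** LJ ** Q) $ i $ j = (P ** L ** Q) $ i $ j + u i * w j" for i j
  proof -
    have "(P ** LJ ** Q) $ i $ j = (\<Sum>k\<in>UNIV. (P ** LJ) $ i $ k * Q $ k $ j)"
      by (simp add: matrix_matrix_mult_def[of "P ** LJ"])
    also have "\<dots> = (\<Sum>k\<in>UNIV. (P ** L) $ i $ k * Q $ k $ j) + u i * w j"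
      unfolding 1 w_def by (simp add: distrib_right sum.distrib sum_distrib_left)
    finally show ?thesis by (simp add: matrix_matrix_mult_def[of "P ** L"])
  qed
  then have "real_mat (P ** LJ ** Q) = (\<chi> i j. (if i = j then real_of_int (d i) else 0)
      + (\<chi> i. real_of_int (u i)) $ i * (\<chi> j. real_of_int (w j)) $ j)"
    by (simp add: real_mat_def vec_eq_iff diag)
  then have "det (real_mat (P ** LJ ** Q)) = real_of_int (u ?z) * real_of_int (w ?z)
      * (\<Prod>i\<in>UNIV - {?z}. real_of_int (d i))"
    using det_diagonal_plus_rank_one[of "\<lambda>i. real_of_int (d i)" ?z
        "\<chi> i. real_of_int (u i)" "\<chi> j. real_of_int (w j)"] dz by simp
  then have "real_of_int (det (P ** LJ ** Q)) = real_of_int (u ?z * w ?z * (\<Prod>i\<in>UNIV - {?z}. d i))"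
    by (simp add: det_real_mat)
  then have "det P * det LJ * det Q = u ?z * w ?z * (\<Prod>i\<in>UNIV - {?z}. d i)"
    unfolding of_int_eq_iff by (simp add: det_mul)
  then have "\<bar>det P\<bar> * \<bar>det LJ\<bar> * \<bar>det Q\<bar> = \<bar>u ?z\<bar> * \<bar>w ?z\<bar> * \<bar>\<Prod>i\<in>UNIV - {?z}. d i\<bar>"
    by (simp flip: abs_mult)
  then have "\<bar>det LJ\<bar> = ?n * (?n * \<bar>\<Prod>i\<in>UNIV - {?z}. d i\<bar>)"
    using abs_det_unimodular[OF PP'] abs_det_unimodular[OF QQ'] by (simp add: u w)
  moreover have "real_mat LJ = (\<chi> i j. RL $ i $ j + 1)"
    by (simp add: LJ_def real_mat_def vec_eq_iff)
  then have "real_of_int (det LJ) = real_of_int (?n * r ^ f * s ^ g)"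
    using det_RL_plus_J by (simp flip: det_real_mat)
  then have "det LJ = ?n * r ^ f * s ^ g" unfolding of_int_eq_iff .
  then have "\<bar>det LJ\<bar> = ?n * (\<bar>r\<bar> ^ f * \<bar>s\<bar> ^ g)" by (simp add: abs_mult power_abs)
  ultimately show ?thesis by simp
qed

text \<open>Column \<open>i\<close> of \<open>P'\<close> has coordinate sum 0, because row
  \<open>zero_index\<close> of \<open>P\<close> is constant and nonzero. On such \<open>x\<close>,
  \<open>L (L - r - s) x = - r s x\<close>; coordinate \<open>i\<close> under \<open>P\<close>
  exhibits \<open>d i\<close> as a divisor.\<close>

lemma diag_dvd:
  assumes "i \<noteq> zero_index"
  shows "d i dvd r * s"
proof -
  let ?z = zero_index
  define x where "x = P' *v axis i 1"
  have Px: "P *v x = axis i 1" by (simp add: x_def P_P'_vec)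
  have dz: "d ?z = 0" by (simp add: d_eq_0_iff)
  obtain q where q: "\<bar>q\<bar> = 1" "\<forall>j. P $ ?z $ j = q" using zero_diag_row_P[OF dz] by (elim exE conjE) (rule that)
  have "q * (\<Sum>j\<in>UNIV. x $ j) = (P *v x) $ ?z"
    by (simp add: matrix_vector_mult_def q sum_distrib_left)
  also have "\<dots> = 0" using assms by (simp add: Px axis_def)
  finally have sum0: "(\<Sum>j\<in>UNIV. x $ j) = 0" using q(1) by auto
  define y where "y = L *v x - (r + s) *s x"
  have "L *v y = L *v (L *v x) - (r + s) *s (L *v x)"
    unfolding y_def matrix_vector_mult_diff_distrib int_matrix_mult_smult ..
  then have "L *v y = (- (r * s)) *s x"
    using sum0 by (simp add: vec_eq_iff int_quad_vec algebra_simps)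
  then have "P *v (L *v y) = (- (r * s)) *s (P *v x)"
    by (simp only: int_matrix_mult_smult)
  then have "d i * (Q' *v y) $ i = - (r * s)"
    using P_mult_A_vec[of y i] by (simp add: Px axis_def)
  then show ?thesis by (metis dvd_minus_iff dvd_triv_left)
qed

text \<open>Primitive kernel vectors of \<open>L - c\<close> are found with the coordinates in
  \<open>T\<close> annihilated; \<open>R\<close> is taken to be \<open>P\<close> or
  \<open>Q'\<close>. Applying \<open>P\<close> to \<open>L *v x = c *s x\<close> gives the relation
  with \<open>d\<close>.\<close>

lemma exists_primitive_eigenvector:
  fixes c k :: int and R :: "int^'n^'n"
  assumes "card T < dim (eigenspace (of_int c))" "\<not> is_unit k"
  shows "\<exists>x. (\<forall>i. d i * (Q' *v x) $ i = c * (P *v x) $ i) \<and> L *v x = c *s x \<and>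
    (\<forall>i\<in>T. (R *v x) $ i = 0) \<and> \<not> (\<forall>i. k dvd x $ i)"
proof -
  have scm: "mat a *v x = a *s x" for a and x :: "'b::comm_ring_1^'n"
    by (simp add: matrix_vector_mult_def mat_def vec_eq_iff if_distrib[of "\<lambda>y. y * _"] cong: if_cong)
  define M where "M = L - mat c"
  have "real_mat M *v x = RL *v x - of_int c *\<^sub>R x" for x
    by (simp add: M_def real_mat_diff real_mat_mat matrix_vector_mult_diff_rdistrib scm scalar_mult_eq_scaleR)
  then have ker: "{x. real_mat M *v x = 0} = eigenspace (of_int c)" by simp
  have "card ((\<lambda>i. R $ i) ` T) \<le> card T" by (rule card_image_le) simp
  then have "card ((\<lambda>i. R $ i) ` T) < dim {x. real_mat M *v x = 0}"
    unfolding ker using assms(1) by linarith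
  from exists_primitive_int_solution[OF _ this assms(2)]
  obtain x where x: "M *v x = 0" "\<forall>a\<in>(\<lambda>i. R $ i) ` T. (\<Sum>j\<in>UNIV. a $ j * x $ j) = 0"
    "\<exists>i. \<not> k dvd x $ i" by auto
  have Lx: "L *v x = c *s x"
    using x(1) by (simp add: M_def matrix_vector_mult_diff_rdistrib scm)
  have "d i * (Q' *v x) $ i = c * (P *v x) $ i" for i
    by (simp add: Lx int_matrix_mult_smult flip: P_mult_A_vec)
  moreover have "\<forall>i\<in>T. (R *v x) $ i = 0"
    using x(2) by (simp add: matrix_vector_mult_def)
  ultimately show ?thesis using Lx x(3) by blast
qed

text \<open>If there were too few such indices, a primitive eigenvector for \<open>r\<close> could
  vanish there in the coordinates of \<open>P\<close>. At the other indices \<open>p^2\<close>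
  divides \<open>r * (P *v x) $ i\<close>, while \<open>r\<close> contains only one factor
  \<open>p\<close>; so \<open>p\<close> would divide all of \<open>x\<close>.\<close>

lemma card_not_dvd_square_ge:
  assumes p: "Factorial_Ring.prime p" and r: "exactly_divides p 1 r"
  shows "f \<le> card {i. \<not> (int p)\<^sup>2 dvd d i}"
proof (rule ccontr)
  assume "\<not> ?thesis"
  then have less: "card {i. \<not> (int p)\<^sup>2 dvd d i} < f" by simp
  have pp: "Factorial_Ring.prime (int p)" and nu: "\<not> is_unit (int p)"
    using p by (auto simp: not_prime_unit)
  obtain x where x: "\<forall>i. d i * (Q' *v x) $ i = r * (P *v x) $ i"
    "\<forall>i\<in>{i. \<not> (int p)\<^sup>2 dvd d i}. (P *v x) $ i = 0" "\<not> (\<forall>i. int p dvd x $ i)"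
    using exists_primitive_eigenvector[OF less nu, of P] by blast
  obtain r' where r': "r = int p * r'" "\<not> int p dvd r'"
    using r pp by (auto simp: exactly_divides_def power2_eq_square elim!: dvdE)
  have "int p dvd (P *v x) $ i" for i
  proof (cases "(int p)\<^sup>2 dvd d i")
    case True
    then have "(int p)\<^sup>2 dvd r * (P *v x) $ i" using x(1) by (metis dvd_mult2)
    then have "int p dvd r' * (P *v x) $ i"
      using pp by (simp add: r' power2_eq_square mult.assoc)
    then show ?thesis using r'(2) pp by (simp add: prime_dvd_mult_iff)
  qed (use x(2) in simp)
  then show False using all_dvd_P_iff x(3) by blast
qed

lemma dvd_Q'_coordinate:
  assumes p: "Factorial_Ring.prime p" and s: "(int p)\<^sup>2 dvd s" and i: "\<not> (int p)\<^sup>2 dvd d i"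
    and x: "d i * (Q' *v x) $ i = s * (P *v x) $ i"
  shows "int p dvd (Q' *v x) $ i"
proof (rule ccontr)
  assume "\<not> int p dvd (Q' *v x) $ i"
  then have "coprime ((int p)\<^sup>2) ((Q' *v x) $ i)"
    using p by (simp add: prime_imp_coprime)
  moreover have "(int p)\<^sup>2 dvd d i * (Q' *v x) $ i" unfolding x using s by simp
  ultimately show False using i by (simp add: coprime_dvd_mult_left_iff)
qed

text \<open>The dual argument in the coordinates of \<open>Q'\<close>: where \<open>p^2\<close> does
  not divide \<open>d i\<close>, the factor \<open>p^2\<close> of \<open>s\<close> forces
  \<open>p\<close> into \<open>(Q' *v x) $ i\<close>. The set includes \<open>zero_index\<close>, as
  \<open>p^2\<close> divides 0.\<close>

lemma card_dvd_square_ge: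
  assumes p: "Factorial_Ring.prime p" and s: "(int p)\<^sup>2 dvd s"
  shows "g \<le> card {i. (int p)\<^sup>2 dvd d i}"
proof (rule ccontr)
  assume "\<not> ?thesis"
  then have less: "card {i. (int p)\<^sup>2 dvd d i} < g" by simp
  have nu: "\<not> is_unit (int p)" using p by (auto simp: not_prime_unit)
  obtain x where x: "\<forall>i. d i * (Q' *v x) $ i = s * (P *v x) $ i"
    "\<forall>i\<in>{i. (int p)\<^sup>2 dvd d i}. (Q' *v x) $ i = 0" "\<not> (\<forall>i. int p dvd x $ i)"
    using exists_primitive_eigenvector[OF less nu, of Q'] by blast
  have "int p dvd (Q' *v x) $ i" for i
    using dvd_Q'_coordinate[OF p s _ x(1)[rule_format]] x(2) by (cases "(int p)\<^sup>2 dvd d i") auto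
  then show False using all_dvd_Q'_iff x(3) by blast
qed

text \<open>Column \<open>zero_index\<close> of \<open>Q\<close> is \<open>\<plusminus>1\<close>, whose coordinate sum is a unit modulo \<open>p\<close>, whereas
  eigenvectors for \<open>s\<close> have coordinate sum \<open>0\<close>; this saves the equation for that index.\<close>
lemma card_dvd_square_ge_coprime:
  assumes p: "Factorial_Ring.prime p" and s: "(int p)\<^sup>2 dvd s" and n: "\<not> int p dvd int CARD('n)"
  shows "g \<le> card ({i. (int p)\<^sup>2 dvd d i} - {zero_index})"
proof (rule ccontr)
  let ?z = zero_index
  assume "\<not> ?thesis"
  then have less: "card ({i. (int p)\<^sup>2 dvd d i} - {?z}) < g" by simp
  have pp: "Factorial_Ring.prime (int p)" and nu: "\<not> is_unit (int p)"
    using p by (auto simp: not_prime_unit)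
  obtain x where x: "\<forall>i. d i * (Q' *v x) $ i = s * (P *v x) $ i" "L *v x = s *s x"
    "\<forall>i\<in>{i. (int p)\<^sup>2 dvd d i} - {?z}. (Q' *v x) $ i = 0" "\<not> (\<forall>i. int p dvd x $ i)"
    using exists_primitive_eigenvector[OF less nu, of Q'] by blast
  define y where "y = Q' *v x"
  have y: "int p dvd y $ i" if "i \<noteq> ?z" for i
    using dvd_Q'_coordinate[OF p s _ x(1)[rule_format]] x(3) that
    by (cases "(int p)\<^sup>2 dvd d i") (auto simp: y_def)
  have "real_vec x \<in> eigenspace (of_int s)"
    by (simp add: real_mat_mult_vec x(2)) (simp add: real_vec_def vec_eq_iff)
  then have "(\<Sum>j\<in>UNIV. real_vec x $ j) = 0"
    using nonzero by (intro sum_eigenspace) auto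
  then have "real_of_int (\<Sum>j\<in>UNIV. x $ j) = 0" by (simp add: real_vec_def)
  then have "(\<Sum>j\<in>UNIV. x $ j) = 0" by (simp only: of_int_eq_0_iff)
  moreover have "x = Q *v y" by (simp add: y_def Q_Q'_vec)
  \<comment> \<open>The zero coordinate sum of \<open>x\<close> is rewritten in terms of
    \<open>y\<close>; modulo \<open>p\<close> only the term of \<open>?z\<close> remains.\<close>
  ultimately have "(\<Sum>j\<in>UNIV. \<Sum>i\<in>UNIV. Q $ j $ i * y $ i) = 0"
    by (simp add: matrix_vector_mult_def)
  then have "(\<Sum>i\<in>UNIV. (\<Sum>j\<in>UNIV. Q $ j $ i) * y $ i) = 0"
    by (subst (asm) sum.swap) (simp add: sum_distrib_right)
  then have "(\<Sum>j\<in>UNIV. Q $ j $ ?z) * y $ ?z + (\<Sum>i\<in>UNIV - {?z}. (\<Sum>j\<in>UNIV. Q $ j $ i) * y $ i) = 0"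
    using sum.remove[of UNIV ?z "\<lambda>i. (\<Sum>j\<in>UNIV. Q $ j $ i) * y $ i"] by simp
  moreover have "int p dvd (\<Sum>i\<in>UNIV - {?z}. (\<Sum>j\<in>UNIV. Q $ j $ i) * y $ i)"
    using y by (intro dvd_sum) auto
  ultimately have 1: "int p dvd (\<Sum>j\<in>UNIV. Q $ j $ ?z) * y $ ?z"
    by (simp add: add_eq_0_iff2)
  have dz: "d ?z = 0" by (simp add: d_eq_0_iff)
  obtain q where q: "\<bar>q\<bar> = 1" "\<forall>j. Q $ j $ ?z = q" using zero_diag_column_Q[OF dz] by (elim exE conjE) (rule that)
  have "int p dvd int CARD('n) * (q * y $ ?z)" using 1 by (simp add: q mult.assoc)
  then have "int p dvd q * y $ ?z" using n pp by (simp add: prime_dvd_mult_iff)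
  moreover have "q = 1 \<or> q = - 1" using q(1) by linarith
  then have "\<not> int p dvd q" using nu by auto
  ultimately have "int p dvd y $ ?z" using pp by (simp add: prime_dvd_mult_iff)
  then have "int p dvd y $ i" for i using y[of i] by (cases "i = ?z") auto
  then show False using all_dvd_Q'_iff x(4) unfolding y_def by blast
qed

end

lemma exactly_divides_iff_multiplicity:
  assumes "Factorial_Ring.prime p" "n \<noteq> 0"
  shows "exactly_divides p a n \<longleftrightarrow> multiplicity (int p) n = a"
proof -
  have "\<not> is_unit (int p)" using assms(1) by (auto simp: not_prime_unit)
  then have iff: "int p ^ m dvd n \<longleftrightarrow> m \<le> multiplicity (int p) n" for m
    using assms(2) by (rule power_dvd_iff_le_multiplicity[rotated])
  show ?thesis unfolding exactly_divides_def iff by auto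
qed

lemma multiplicity_abs_int: "multiplicity (q :: int) \<bar>n\<bar> = multiplicity q n"
  using multiplicity_normalize_right[of q n] by simp

section \<open>Counting diagonal entries by their p-adic valuation\<close>

context diagonalized_laplacian
begin

abbreviation mult_class :: "nat \<Rightarrow> nat \<Rightarrow> 'n set" where
  "mult_class p m \<equiv> {i. d i \<noteq> 0 \<and> multiplicity (int p) (d i) = m}"

lemma multiplicity_le_3:
  assumes p: "Factorial_Ring.prime p" and r: "exactly_divides p 1 r" and s: "exactly_divides p 2 s"
    and i: "d i \<noteq> 0"
  shows "multiplicity (int p) (d i) \<le> 3"
proof -
  have pp: "Factorial_Ring.prime (int p)" using p by simp
  have "d i dvd r * s" using i by (intro diag_dvd) (simp add: d_eq_0_iff)
  then have "multiplicity (int p) (d i) \<le> multiplicity (int p) (r * s)"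
    using nonzero by (intro dvd_imp_multiplicity_le) auto
  also have "\<dots> = 3"
    using pp nonzero r s exactly_divides_iff_multiplicity[OF p]
    by (simp add: prime_elem_multiplicity_mult_distrib)
  finally show ?thesis .
qed

text \<open>The free weight \<open>w\<close> serves two counts: the constant 1 gives the number of
  nonzero entries, the identity the valuation of their product.\<close>

lemma sum_over_mult_classes:
  fixes w :: "nat \<Rightarrow> nat"
  assumes "\<And>i. d i \<noteq> 0 \<Longrightarrow> multiplicity (int p) (d i) \<le> 3"
  shows "(\<Sum>i\<in>UNIV - {zero_index}. w (multiplicity (int p) (d i))) =
    w 0 * card (mult_class p 0) + w 1 * card (mult_class p 1) + w 2 * card (mult_class p 2)
    + w 3 * card (mult_class p 3)"
proof -
  have "(\<Sum>i\<in>UNIV - {zero_index}. w (multiplicity (int p) (d i)))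
    = (\<Sum>m\<le>3. \<Sum>i\<in>{i \<in> UNIV - {zero_index}. multiplicity (int p) (d i) = m}. w (multiplicity (int p) (d i)))"
    using assms by (intro sum.group[symmetric]) (auto simp: d_eq_0_iff)
  also have "\<dots> = (\<Sum>m\<le>3. w m * card (mult_class p m))"
    by (intro sum.cong refl) (simp add: d_eq_0_iff)
  also have "\<dots> = w 0 * card (mult_class p 0) + w 1 * card (mult_class p 1) + w 2 * card (mult_class p 2)
    + w 3 * card (mult_class p 3)"
    by (simp add: eval_nat_numeral)
  finally show ?thesis .
qed

lemma mult_class_counts:
  assumes p: "Factorial_Ring.prime p" and r: "exactly_divides p 1 r" and s: "exactly_divides p 2 s"
    and gam: "exactly_divides p \<gamma> (int CARD('n))"
  defines "e \<equiv> \<lambda>m. card (mult_class p m)"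
  shows "e 0 + e 1 + e 2 + e 3 = f + g" "\<gamma> + e 1 + 2 * e 2 + 3 * e 3 = f + 2 * g"
    "p_rank p L = e 0" "f \<le> e 0 + e 1" "g \<le> e 2 + e 3 + 1" "\<gamma> = 0 \<Longrightarrow> g \<le> e 2 + e 3"
proof -
  have pp: "Factorial_Ring.prime (int p)" and nu: "\<not> is_unit (int p)"
    using p by (auto simp: not_prime_unit)
  note le3 = multiplicity_le_3[OF p r s]
  let ?z = zero_index
  have mr: "multiplicity (int p) r = 1" and ms: "multiplicity (int p) s = 2"
    and mn: "multiplicity (int p) (int CARD('n)) = \<gamma>"
    using r s gam exactly_divides_iff_multiplicity[OF p nonzero(1)]
      exactly_divides_iff_multiplicity[OF p nonzero(2)]
      exactly_divides_iff_multiplicity[OF p, of "int CARD('n)"] by auto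
  have cardz: "card (UNIV - {?z}) = f + g"
    using dim_eigenspaces by simp
  have ec: "card (mult_class p m) = e m" for m by (simp only: e_def)
  note sums = sum_over_mult_classes[OF le3, unfolded ec]
  show "e 0 + e 1 + e 2 + e 3 = f + g"
    using sums[of "\<lambda>_. 1"] cardz by simp
  have prod0: "(\<Prod>i\<in>UNIV - {?z}. d i) \<noteq> 0"
    by (simp add: d_eq_0_iff)
  \<comment> \<open>Comparing valuations on the two sides of
    \<open>card_mult_prod_diag\<close>.\<close>
  have "multiplicity (int p) (int CARD('n) * \<bar>\<Prod>i\<in>UNIV - {?z}. d i\<bar>)
      = \<gamma> + multiplicity (int p) (\<Prod>i\<in>UNIV - {?z}. d i)"
    using pp prod0 mn by (simp add: prime_elem_multiplicity_mult_distrib multiplicity_abs_int)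
  also have "multiplicity (int p) (\<Prod>i\<in>UNIV - {?z}. d i) = (\<Sum>i\<in>UNIV - {?z}. multiplicity (int p) (d i))"
    using pp by (intro prime_elem_multiplicity_prod_distrib) (auto simp: d_eq_0_iff)
  also have "\<dots> = e 1 + 2 * e 2 + 3 * e 3"
    using sums[of "\<lambda>m. m"] by simp
  finally have "multiplicity (int p) (\<bar>r\<bar> ^ f * \<bar>s\<bar> ^ g) = \<gamma> + (e 1 + 2 * e 2 + 3 * e 3)"
    unfolding card_mult_prod_diag .
  moreover have "multiplicity (int p) (\<bar>r\<bar> ^ f * \<bar>s\<bar> ^ g) = f + 2 * g"
    using pp nonzero mr ms
    by (simp add: prime_elem_multiplicity_mult_distrib prime_elem_multiplicity_power_distrib
        multiplicity_abs_int)
  ultimately show "\<gamma> + e 1 + 2 * e 2 + 3 * e 3 = f + 2 * g" by simp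
  define w where "w = (\<lambda>i. multiplicity (int p) (d i))"
  have mc: "mult_class p m = {i. i \<noteq> ?z \<and> w i = m}" for m
    by (simp add: w_def d_eq_0_iff)
  have w3: "w i \<le> 3" if "i \<noteq> ?z" for i using le3[of i] that by (simp add: w_def d_eq_0_iff)
  have dvd_iff: "int p ^ m dvd d i \<longleftrightarrow> i = ?z \<or> m \<le> w i" for i m
  proof (cases "d i = 0")
    case True
    then show ?thesis using d_eq_0_iff[of i] by simp
  next
    case False
    then show ?thesis
      using power_dvd_iff_le_multiplicity[OF False nu, of m] d_eq_0_iff[of i] by (simp add: w_def)
  qed
  have "int p dvd d i \<longleftrightarrow> i = ?z \<or> w i \<noteq> 0" for i
    using dvd_iff[of 1 i] by (simp add: Suc_le_eq)
  then have "{i. \<not> int p dvd d i} = mult_class p 0"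
    unfolding mc by simp
  then show "p_rank p L = e 0" unfolding p_rank_eq_card[OF p] by (simp only: e_def)
  have "{i. \<not> (int p)\<^sup>2 dvd d i} = mult_class p 0 \<union> mult_class p 1"
    unfolding mc dvd_iff by auto
  moreover have "card (mult_class p a \<union> mult_class p b) = e a + e b" if "a \<noteq> b" for a b
    unfolding e_def mc by (rule card_Un_disjoint) (use that in auto)
  note card_Un = this
  ultimately have "card {i. \<not> (int p)\<^sup>2 dvd d i} = e 0 + e 1" by simp
  then show "f \<le> e 0 + e 1" using card_not_dvd_square_ge[OF p r] by simp
  have "2 \<le> w i \<longleftrightarrow> w i = 2 \<or> w i = 3" if "i \<noteq> ?z" for i
    using w3[OF that] by linarith
  then have m23: "{i. (int p)\<^sup>2 dvd d i} - {?z} = mult_class p 2 \<union> mult_class p 3"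
    unfolding mc dvd_iff by auto
  have c23: "card ({i. (int p)\<^sup>2 dvd d i} - {?z}) = e 2 + e 3"
    unfolding m23 by (simp add: card_Un)
  have s2: "(int p)\<^sup>2 dvd s" using s by (simp add: exactly_divides_def)
  \<comment> \<open>The zero entry is divisible by \<open>p^2\<close> but belongs to no valuation
    class; this is the summand 1 in the bound for \<open>g\<close>.\<close>
  have "?z \<in> {i. (int p)\<^sup>2 dvd d i}" using dvd_iff[of 2 ?z] by simp
  from card.remove[OF _ this] have "card {i. (int p)\<^sup>2 dvd d i} = Suc (e 2 + e 3)"
    unfolding c23 by simp
  then show "g \<le> e 2 + e 3 + 1" using card_dvd_square_ge[OF p s2] by simp
  show "g \<le> e 2 + e 3" if "\<gamma> = 0"
  proof -
    have "\<not> int p dvd int CARD('n)" using gam that by (simp add: exactly_divides_def)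
    then show ?thesis using card_dvd_square_ge_coprime[OF p s2] c23 by simp
  qed
qed

text \<open>With \<open>\<delta> = g - (e\<^sub>2 + e\<^sub>3) \<in> {0, 1}\<close>, the counts above determine the numbers \<open>e\<^sub>m\<close> of
  diagonal entries of valuation \<open>m\<close> in terms of \<open>e\<^sub>0\<close>, \<open>\<gamma>\<close> and \<open>\<delta>\<close>.\<close>
lemma sylow_torsion_cokernel_type:
  assumes p: "Factorial_Ring.prime p" and r: "exactly_divides p 1 r" and s: "exactly_divides p 2 s"
    and gam: "exactly_divides p \<gamma> (int CARD('n))"
  defines "e0 \<equiv> int (p_rank p L)" and "Kp \<equiv> sylow_part p (torsion_part (cokernel L))"
  shows "has_type3 Kp p (int f - e0) (int g + int \<gamma> - e0) (e0 - int \<gamma>) \<or>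
      has_type3 Kp p (int f + 1 - e0) (int g + int \<gamma> - 2 - e0) (e0 - int \<gamma> + 1)"
    and "\<gamma> = 0 \<Longrightarrow> has_type3 Kp p (int f - e0) (int g - e0) e0"
proof -
  define e where "e = (\<lambda>m. card (mult_class p m))"
  have e: "card (mult_class p m) = e m" for m by (simp add: e_def)
  note counts = mult_class_counts[OF p r s gam, unfolded e]
  have iso: "Kp \<cong> abelian_type3 p (e 1) (e 2) (e 3)"
    unfolding Kp_def e_def by (rule sylow_torsion_cokernel_iso[OF p multiplicity_le_3[OF p r s]])
  \<comment> \<open>Nonnegativity in \<open>has_type3\<close> is automatic, since the exponents are
    cardinalities.\<close>
  have type: "has_type3 Kp p a b c" if "a = int (e 1)" "b = int (e 2)" "c = int (e 3)" for a b c
    using iso that by (simp add: has_type3_def)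
  have e0: "e0 = int (e 0)" by (simp add: e0_def counts(3))
  have case0: "has_type3 Kp p (int f - e0) (int g + int \<gamma> - e0) (e0 - int \<gamma>)" if "g = e 2 + e 3"
    using counts(1,2) that unfolding e0 by (intro type; linarith)
  have case1: "has_type3 Kp p (int f + 1 - e0) (int g + int \<gamma> - 2 - e0) (e0 - int \<gamma> + 1)"
    if "g = e 2 + e 3 + 1"
    using counts(1,2) that unfolding e0 by (intro type; linarith)
  \<comment> \<open>The total \<open>f + g\<close> and \<open>f \<le> e 0 + e 1\<close> give
    \<open>e 2 + e 3 \<le> g\<close>; the other bound leaves a gap of at most 1.\<close>
  have "g = e 2 + e 3 \<or> g = e 2 + e 3 + 1" using counts(1,4,5) by linarith
  then show "has_type3 Kp p (int f - e0) (int g + int \<gamma> - e0) (e0 - int \<gamma>) \<or>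
      has_type3 Kp p (int f + 1 - e0) (int g + int \<gamma> - 2 - e0) (e0 - int \<gamma> + 1)"
    using case0 case1 by blast
  show "has_type3 Kp p (int f - e0) (int g - e0) e0" if "\<gamma> = 0"
  proof -
    have "g = e 2 + e 3" using counts(1,4) counts(6)[OF that] by linarith
    then show ?thesis using case0 that by simp
  qed
qed

end

section \<open>Strongly regular graphs\<close>

lemma laplacian_entry:
  "laplacian E k $ i $ j = (if i = j then int k else 0) - (if E i j then 1 else 0)"
  by (simp add: laplacian_def adj_matrix_def mat_def)

text \<open>Counting common neighbours expresses the square of the adjacency matrix through
  \<open>I\<close>, \<open>A\<close> and \<open>J\<close>; the coefficients result from substituting
  \<open>A = k I - L\<close>.\<close>

lemma srg_laplacian_square:
  assumes "srg E v k lam mu"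
  shows "(laplacian E k ** laplacian E k) $ i $ j =
    (2 * int k - int lam + int mu) * laplacian E k $ i $ j
    + (if i = j then int k * int k + int k - (2 * int k - int lam + int mu) * int k - int mu else 0) + int mu"
proof -
  have irr: "\<not> E x x" and sym: "E x y = E y x" and deg: "card {y. E x y} = k"
    and adj: "E x y \<Longrightarrow> card {z. E x z \<and> E y z} = lam"
    and nadj: "x \<noteq> y \<Longrightarrow> \<not> E x y \<Longrightarrow> card {z. E x z \<and> E y z} = mu" for x y
    using assms unfolding srg_def by blast+
  have "(laplacian E k ** laplacian E k) $ i $ j
    = (\<Sum>l\<in>UNIV. laplacian E k $ i $ l * laplacian E k $ l $ j)"
    by (simp add: matrix_matrix_mult_def)
  \<comment> \<open>The indices \<open>l = i\<close> and \<open>l = j\<close> contribute the degree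
    terms; every other \<open>l\<close> contributes 1 exactly when it is a common neighbour.\<close>
  also have "\<dots> = (\<Sum>l\<in>UNIV. (if l = i then int k * laplacian E k $ i $ j else 0)
      - (if l = j then (if E i j then int k else 0) else 0) + (if E i l \<and> E j l then 1 else 0))"
  proof (rule sum.cong[OF refl])
    fix l
    show "laplacian E k $ i $ l * laplacian E k $ l $ j = (if l = i then int k * laplacian E k $ i $ j else 0)
      - (if l = j then (if E i j then int k else 0) else 0) + (if E i l \<and> E j l then 1 else 0)"
      using sym[of l j] irr[of i] by (cases "l = i"; cases "l = j") (simp_all add: laplacian_entry)
  qed
  also have "\<dots> = int k * laplacian E k $ i $ j - (if E i j then int k else 0) + int (card {l. E i l \<and> E j l})"
    by (simp add: sum.distrib sum_subtractf sum.If_cases)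
  also have "\<dots> = (2 * int k - int lam + int mu) * laplacian E k $ i $ j
    + (if i = j then int k * int k + int k - (2 * int k - int lam + int mu) * int k - int mu else 0) + int mu"
  proof (cases "i = j")
    case True
    then show ?thesis using deg[of j] by (simp add: laplacian_entry irr)
  next
    case False
    then show ?thesis using adj[of i j] nadj[of i j] by (cases "E i j") (simp_all add: laplacian_entry)
  qed
  finally show ?thesis .
qed

text \<open>An eigenvector for a nonzero eigenvalue has coordinate sum 0, so the term with
  \<open>J\<close> disappears and the eigenvalue is a root of \<open>t^2 = b t + c\<close>. Two
  distinct roots determine \<open>b\<close> and \<open>c\<close> by Vieta.\<close>

lemma srg_two_eigenvalue_laplacian:
  fixes E :: "'n::finite \<Rightarrow> 'n \<Rightarrow> bool" and r s :: int
  assumes srg: "srg E v k lam mu"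
    and eig_r: "is_eigenvalue (real_mat (laplacian E k)) (of_int r)"
    and eig_s: "is_eigenvalue (real_mat (laplacian E k)) (of_int s)"
    and rs: "r \<noteq> 0" "s \<noteq> 0" "r \<noteq> s"
  shows "two_eigenvalue_laplacian (laplacian E k) r s (int mu)"
proof -
  define L where "L = laplacian E k"
  define b where "b = 2 * int k - int lam + int mu"
  define c where "c = int k * int k + int k - b * int k - int mu"
  have sq: "(L ** L) $ i $ j = b * L $ i $ j + (if i = j then c else 0) + int mu" for i j
    unfolding L_def b_def c_def by (rule srg_laplacian_square[OF srg])
  have E_sym: "E x y = E y x" and deg: "card {y. E x y} = k" for x y
    using srg unfolding srg_def by blast+
  have L_sym: "L $ i $ j = L $ j $ i" for i j
    using E_sym[of i j] by (simp add: L_def laplacian_entry)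
  have L_row: "(\<Sum>j\<in>UNIV. L $ i $ j) = 0" for i
    by (simp add: L_def laplacian_entry sum_subtractf sum.If_cases deg)
  have L_col: "(\<Sum>i\<in>UNIV. L $ i $ j) = 0" for j
    unfolding L_row[of j, symmetric] by (rule sum.cong[OF refl L_sym])
  have root: "t * t = b * t + c" if eig: "is_eigenvalue (real_mat L) (of_int t)" and t: "t \<noteq> 0" for t
  proof -
    obtain x where x: "x \<noteq> 0" "real_mat L *v x = of_int t *\<^sub>R x"
      using eig unfolding is_eigenvalue_def by (elim exE conjE) (rule that)
    have entry: "(\<Sum>j\<in>UNIV. of_int (L $ i $ j) * x $ j) = of_int t * x $ i" for i
      using x(2) by (simp add: vec_eq_iff matrix_vector_mult_def real_mat_def)
    have "of_int t * (\<Sum>i\<in>UNIV. x $ i) = (\<Sum>i\<in>UNIV. \<Sum>j\<in>UNIV. of_int (L $ i $ j) * x $ j)"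
      by (simp add: entry sum_distrib_left)
    also have "\<dots> = (\<Sum>j\<in>UNIV. \<Sum>i\<in>UNIV. of_int (L $ i $ j) * x $ j)"
      by (rule sum.swap)
    also have "\<dots> = (\<Sum>j\<in>UNIV. of_int (\<Sum>i\<in>UNIV. L $ i $ j) * x $ j)"
      by (simp add: sum_distrib_right)
    also have "\<dots> = 0" by (simp add: L_col)
    finally have sum0: "(\<Sum>i\<in>UNIV. x $ i) = 0" using t by simp
    obtain i where i: "x $ i \<noteq> 0" using x(1) unfolding vec_eq_iff zero_index by blast
    have "real_mat (L ** L) *v x = real_mat L *v (real_mat L *v x)"
      by (simp add: real_mat_mult matrix_vector_mul_assoc)
    then have "(real_mat (L ** L) *v x) $ i = of_int t * (of_int t * x $ i)"
      by (simp add: x(2) matrix_vector_mult_scaleR)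
    moreover have "(real_mat (L ** L) *v x) $ i
      = (\<Sum>j\<in>UNIV. of_int (b * L $ i $ j + (if i = j then c else 0) + int mu) * x $ j)"
      by (simp add: real_mat_def sq matrix_vector_mult_def)
    moreover have "\<dots> = of_int b * (\<Sum>j\<in>UNIV. of_int (L $ i $ j) * x $ j) + of_int c * x $ i
        + of_int (int mu) * (\<Sum>j\<in>UNIV. x $ j)"
      by (simp add: distrib_right sum.distrib sum_distrib_left mult.assoc if_distrib[of of_int]
          if_distrib[of "\<lambda>y. y * _"] cong: if_cong)
    ultimately have "of_int t * (of_int t * x $ i) = of_int b * (of_int t * x $ i) + of_int c * x $ i"
      unfolding entry sum0 by simp
    then have "(of_int t * of_int t) * x $ i = (of_int b * of_int t + of_int c) * x $ i"
      by (simp add: distrib_right mult.assoc)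
    then have "real_of_int (t * t) = real_of_int (b * t + c)" using i by simp
    then show ?thesis by (simp only: of_int_eq_iff)
  qed
  have R: "r * r = b * r + c" and S: "s * s = b * s + c"
    using root[OF eig_r[folded L_def] rs(1)] root[OF eig_s[folded L_def] rs(2)] .
  have "(r - s) * (r + s) = r * r - s * s" by (simp add: algebra_simps)
  also have "\<dots> = (r - s) * b" unfolding R S by (simp add: algebra_simps)
  finally have b: "b = r + s" using rs(3) mult_left_cancel[of "r - s" "r + s" b] by simp
  have "c = r * r - b * r" unfolding R by simp
  also have "\<dots> = - (r * s)" unfolding b by (simp add: algebra_simps)
  finally have "c = - (r * s)" .
  then have quad: "(L ** L) $ i $ j = (r + s) * L $ i $ j - (if i = j then r * s else 0) + int mu" for i j
    by (simp add: sq b)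
  show ?thesis
    unfolding L_def[symmetric] by (intro two_eigenvalue_laplacian.intro L_sym L_row quad rs)
qed

theorem theorem3p8:
  fixes E :: "'n::finite \<Rightarrow> 'n \<Rightarrow> bool"
    and v k lam mu f g p \<gamma> :: nat and r s :: int
  assumes srg: "srg E v k lam mu"
    and conn: "graph_connected E"
    and eig_r: "is_eigenvalue (real_mat (laplacian E k)) (of_int r)"
    and eig_s: "is_eigenvalue (real_mat (laplacian E k)) (of_int s)"
    and rs: "r \<noteq> 0" "s \<noteq> 0" "r \<noteq> s"
    and spec: "{c. is_eigenvalue (real_mat (laplacian E k)) c} = {0, of_int r, of_int s}"
    and f: "f = eig_mult (real_mat (laplacian E k)) (of_int r)"
    and g: "g = eig_mult (real_mat (laplacian E k)) (of_int s)"
    and p: "Factorial_Ring.prime p"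
    and pK: "p dvd card (carrier (critical_group E k))"
    and gam: "exactly_divides p \<gamma> (int v)"
  shows
    "(exactly_divides p 1 r \<and> exactly_divides p 2 s \<longrightarrow>
       (let e0 = int (p_rank p (laplacian E k)); Kp = sylow_part p (critical_group E k) in
         (has_type3 Kp p (int f - e0) (int g + int \<gamma> - e0) (e0 - int \<gamma>) \<or>
          has_type3 Kp p (int f + 1 - e0) (int g + int \<gamma> - 2 - e0) (e0 - int \<gamma> + 1)) \<and>
         (\<gamma> = 0 \<longrightarrow> has_type3 Kp p (int f - e0) (int g - e0) e0))) \<and>
     (exactly_divides p 1 s \<and> exactly_divides p 2 r \<longrightarrow>
       (let e0 = int (p_rank p (laplacian E k)); Kp = sylow_part p (critical_group E k) in
         (has_type3 Kp p (int g - e0) (int f + int \<gamma> - e0) (e0 - int \<gamma>) \<or>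
          has_type3 Kp p (int g + 1 - e0) (int f + int \<gamma> - 2 - e0) (e0 - int \<gamma> + 1)) \<and>
         (\<gamma> = 0 \<longrightarrow> has_type3 Kp p (int g - e0) (int f - e0) e0)))"
proof -
  obtain P P' Q Q' :: "int^'n^'n" and d where
    PQ: "P ** P' = mat 1" "P' ** P = mat 1" "Q ** Q' = mat 1" "Q' ** Q = mat 1"
    and D: "P ** laplacian E k ** Q = (\<chi> i j. if i = j then d i else 0)"
    by (rule int_matrix_diagonalize)
  have diag: "int_diagonalization (laplacian E k) P P' Q Q' d"
    using PQ D by unfold_locales
  interpret rs: diagonalized_laplacian "laplacian E k" r s "int mu" P P' Q Q' d
    using srg_two_eigenvalue_laplacian[OF srg eig_r eig_s rs] diag
    by (simp add: diagonalized_laplacian_def)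
  \<comment> \<open>The same diagonalisation with \<open>r\<close> and \<open>s\<close> exchanged
    yields the second half of the statement.\<close>
  interpret sr: diagonalized_laplacian "laplacian E k" s r "int mu" P P' Q Q' d
    using srg_two_eigenvalue_laplacian[OF srg eig_s eig_r rs(2,1) rs(3)[symmetric]] diag
    by (simp add: diagonalized_laplacian_def)
  have n: "exactly_divides p \<gamma> (int CARD('n))" using gam srg by (simp add: srg_def)
  show ?thesis
    using rs.sylow_torsion_cokernel_type[OF p _ _ n] sr.sylow_torsion_cokernel_type[OF p _ _ n]
    unfolding f g eig_mult_def critical_group_eq_torsion_part Let_def by blast
qed

end
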